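(* Assume the standing hypotheses and the decomposition hypothesis of the context, that $\nu_\infty:=\dim\mathrm{Ker}\,B(\infty)=0$, and that there exist constants $R>0$ and $\lambda\in(0,a_\infty)$ such that $$|\mathcal L(u)-\tfrac12(B(\infty)u,u)_H|\le\lambda\|u\|^2\quad\text{for all }u\in\bar B_H(\infty,R),$$ $$\|A(u)-B(\infty)u\|\le\lambda\|u\|\quad\text{for all }u\in\bar B_H(\infty,R)\cap X.$$ Let $\mu_\infty=\dim H^-_\infty$. (a) If $\mu_\infty=0$, then there exist $\mathfrak R>0$ and a homeomorphism $\phi$ from $B_H(\infty,\mathfrak R)$ onto an open subset of $H$ such that for all $u\in B_H(\infty,\mathfrak R)$, $$\mathcal L(\phi(u))=\|u\|^2,\qquad \frac{\|u\|}{\sqrt{2a_\infty}}\le\|\phi(u)\|\le\frac{1}{\sqrt{a_\infty-\lambda}}\|u\|.$$ (b) If $\mu_\infty>0$, then there exist $\mathfrak R>0$ and a homeomorphism $\phi$ from $B_{H^+_\infty}(\infty,\mathfrak R)\oplus H^-_\infty$ onto an open subset of $H$ such that for all $(u,v)\in B_{H^+_\infty}(\infty,\mathfrak R)\times H^-_\infty$, $$\mathcal L(\phi(u+v))=\|u\|^2-\|v\|^2,\qquad \frac{\|u\|}{\sqrt{2\|B(\infty)\|}}\le\|P^+_\infty\phi(u+v)\|\le\frac{\|u\|}{\sqrt{a_\infty-\lambda}},$$ and $P^-_\infty\circ\phi\bigl(B_{H^+_\infty}(\infty,\mathfrak R)\oplus H^-_\infty\bigr)=H^-_\infty$, where $P^+_\infty$,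 $P^-_\infty$ are the orthogonal projections onto $H^+_\infty$, $H^-_\infty$.
   Context: Conventions. For a normed space $E$: $B_E(\infty,R)=\{\|x\|_E>R\}$, $\bar B_E(\infty,R)=\{\|x\|_E\ge R\}$. A neighborhood of infinity contains some $B_E(\infty,R)$. A map $f$ on an open set is continuously directional differentiable if $Df(x)(u)=\lim_{t\to0}(f(x+tu)-f(x))/t$ exists for all $x$, $u$ and $x\mapsto Df(x)(u)$ is continuous for each $u$. Standing hypotheses. $H$ is a real Hilbert space with inner product $(\cdot,\cdot)_H$ and norm $\|\cdot\|$; $X$ is a Banach space with norm $\|\cdot\|_X$, $X\subset H$ dense, $\|x\|\le\|x\|_X$ for $x\in X$. $V_\infty$ is an open neighborhood of infinity in $H$ ($R$ in the claim is such that $\bar B_H(\infty,R)\subset V_\infty$); $V_\infty^X$ is $V_\infty\cap X$ with the topology of $X$. $\mathcal L:V_\infty\to\mathbb R$ is continuous and continuously directional differentiable. There is a continuous and continuously directional differentiable $A:V^X_\infty\to X$ with $D\mathcal L(x)(u)=(A(x),u)_H$ for $x\in V_\infty\cap X$, $u\in X$. There is a map $B:(V_\infty\cap X)\cup\{\infty\}\to L_s(H)$ (bounded self-adjoint operators on $H$) with $B(\infty)(X)\subset X$ and $(DA(x)(u),v)_H=(B(x)u,v)_H$ for $x\in V_\infty\cap X$, $u,v\in X$. Either $0\notin\sigma(B(\infty))$ or $0$ is an isolated point of $\sigma(B(\infty))$. If $u\in H$ and $B(\infty)u\in X$, then $u\in X$. Decomposition hypothesis. $B(x)=P(x)+Q(x)$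 for $x\in(V_\infty\cap X)\cup\{\infty\}$ with $P(x):H\to H$ positive definite linear and $Q(x):H\to H$ compact linear, such that: all eigenfunctions of $B(\infty)$ with negative eigenvalues lie in $X$; for every sequence $\{x_k\}\subset V_\infty\cap X$ with $\|x_k\|\to\infty$, $\|P(x_k)u-P(\infty)u\|\to0$ for all $u\in H$; $\|Q(x)-Q(\infty)\|_{L(H)}\to0$ as $x\in V_\infty\cap X$, $\|x\|\to\infty$; for every sequence $\{x_n\}\subset V_\infty\cap X$ with $\|x_n\|\to\infty$ there are $C_0>0$, $n_0$ with $(P(x_n)u,u)_H\ge C_0\|u\|^2$ for all $u\in H$, $n\ge n_0$. Notation. $H^+_\infty$ and $H^-_\infty$ are the positive and negative definite (spectral) subspaces of $B(\infty)$ (here $H=H^+_\infty\oplus H^-_\infty$, $\dim H^-_\infty<\infty$), and $a_\infty>0$ is a constant with $(B(\infty)u,u)_H\ge2a_\infty\|u\|^2$ for $u\in H^+_\infty$ and $(B(\infty)u,u)_H\le-2a_\infty\|u\|^2$ for $u\in H^-_\infty$.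
   Formalization: In (a) the lower bound ‖u‖/√(2a_∞), which fails for L(u)=u²/2 on ℝ with a_∞=1/10, is replaced by ‖u‖/√(2‖B(∞)‖) as in (b); in (b) the equation P^-_∞∘φ(…)=H^-_∞ is claimed only if H^+_∞≠{0}, since otherwise the domain is empty. *)

theory Defs
  imports "HOL-Analysis.Analysis"
begin

definition ball_infty :: "'a::real_normed_vector set \<Rightarrow> real \<Rightarrow> 'a set" where
  "ball_infty E r = {x \<in> E. norm x > r}"

definition cball_infty :: "'a::real_normed_vector set \<Rightarrow> real \<Rightarrow> 'a set" where
  "cball_infty E r = {x \<in> E. norm x \<ge> r}"

definition has_dir_deriv ::
  "('a::real_normed_vector \<Rightarrow> 'b::real_normed_vector) \<Rightarrow> 'a \<Rightarrow> 'a \<Rightarrow> 'b \<Rightarrow> bool" where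
  "has_dir_deriv f x u d \<longleftrightarrow> ((\<lambda>t::real. (f (x + t *\<^sub>R u) - f x) /\<^sub>R t) \<longlongrightarrow> d) (at 0)"

definition dir_deriv ::
  "('a::real_normed_vector \<Rightarrow> 'b::real_normed_vector) \<Rightarrow> 'a \<Rightarrow> 'a \<Rightarrow> 'b" where
  "dir_deriv f x u = (THE d. has_dir_deriv f x u d)"

text \<open>Meant for open sets: then the values of the total function outside the set
  do not influence the limits.\<close>
definition cont_dir_differentiable_on ::
  "'a set \<Rightarrow> ('a::real_normed_vector \<Rightarrow> 'b::real_normed_vector) \<Rightarrow> bool" where
  "cont_dir_differentiable_on U f \<longleftrightarrow>
     (\<forall>x\<in>U. \<forall>u. \<exists>d. has_dir_deriv f x u d) \<and>
     (\<forall>u. continuous_on U (\<lambda>x. dir_deriv f x u))"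

definition self_adjoint :: "('a::real_inner \<Rightarrow>\<^sub>L 'a) \<Rightarrow> bool" where
  "self_adjoint T \<longleftrightarrow> (\<forall>u v. inner (T u) v = inner u (T v))"

text \<open>No symmetry is required here.\<close>
definition positive_definite :: "('a::real_inner \<Rightarrow>\<^sub>L 'a) \<Rightarrow> bool" where
  "positive_definite T \<longleftrightarrow> (\<forall>u. u \<noteq> 0 \<longrightarrow> inner (T u) u > 0)"

definition compact_op :: "('a::real_normed_vector \<Rightarrow>\<^sub>L 'b::real_normed_vector) \<Rightarrow> bool" where
  "compact_op T \<longleftrightarrow> compact (closure (blinfun_apply T ` cball 0 1))"

text \<open>Real spectrum. For self-adjoint operators on a real Hilbert space it agrees with the
  spectrum of the complexification.\<close>
definition op_spectrum :: "('a::real_normed_vector \<Rightarrow>\<^sub>L 'a) \<Rightarrow> real set" where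
  "op_spectrum T =
     {c. \<not> (\<exists>S::'a \<Rightarrow>\<^sub>L 'a. (T - c *\<^sub>R id_blinfun) o\<^sub>L S = id_blinfun \<and>
                              S o\<^sub>L (T - c *\<^sub>R id_blinfun) = id_blinfun)}"

text \<open>The positive and negative definite spectral subspaces of a bounded self-adjoint
  operator on a Hilbert space. A closed invariant subspace reduces a self-adjoint operator, so by
  the spectral theorem the family of closed invariant subspaces on which the quadratic form is
  positive (negative) definite has a largest member, the range of the spectral projection of
  \<open>(0,\<infinity>)\<close> (of \<open>(-\<infinity>,0)\<close>); the union of the family is that member.\<close>
definition pos_subspace :: "('a::real_inner \<Rightarrow>\<^sub>L 'a) \<Rightarrow> 'a set" where
  "pos_subspace T = \<Union>{S. subspace S \<and> closed S \<and> blinfun_apply T ` S \<subseteq> S \<and>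
                          (\<forall>u\<in>S. u \<noteq> 0 \<longrightarrow> inner (T u) u > 0)}"

definition neg_subspace :: "('a::real_inner \<Rightarrow>\<^sub>L 'a) \<Rightarrow> 'a set" where
  "neg_subspace T = \<Union>{S. subspace S \<and> closed S \<and> blinfun_apply T ` S \<subseteq> S \<and>
                          (\<forall>u\<in>S. u \<noteq> 0 \<longrightarrow> inner (T u) u < 0)}"

text \<open>The library's \<open>dim\<close> is \<open>0\<close> on infinite-dimensional subspaces, which would make
  \<open>dim S = 0\<close> and \<open>dim S > 0\<close> mean the wrong thing there.\<close>
definition edim :: "'a::real_vector set \<Rightarrow> enat" where
  "edim S = (if \<exists>b. finite b \<and> S \<subseteq> span b then enat (dim S) else \<infinity>)"

definition orth_proj :: "'a::real_inner set \<Rightarrow> 'a \<Rightarrow> 'a" where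
  "orth_proj S x = (THE y. y \<in> S \<and> (\<forall>w\<in>S. inner (x - y) w = 0))"

definition homeo_onto_open_subset ::
  "'a::topological_space set \<Rightarrow> ('a \<Rightarrow> 'b::topological_space) \<Rightarrow> 'b set \<Rightarrow> bool" where
  "homeo_onto_open_subset D f W \<longleftrightarrow>
     open (f ` D) \<and> f ` D \<subseteq> W \<and> (\<exists>g. homeomorphism D (f ` D) f g)"

end

theory Submission
  imports Defs
begin

text \<open>Write \<open>B\<close> for \<open>Binf\<close>, \<open>b x = inner (B x) x / 2\<close>, \<open>M\<close> and \<open>N\<close> for the positive and negative
subspaces of \<open>B\<close>, and \<open>x = u + v\<close> with \<open>u \<in> M\<close>, \<open>v \<in> N\<close>.  Outside a ball, \<open>L\<close> is a perturbation of the
quadratic saddle \<open>b\<close>: the values differ by at most \<open>l * (norm x)\<^sup>2\<close> and the gradients by at most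
\<open>l * norm x\<close>, while \<open>b\<close> grows in \<open>M\<close> and decays in \<open>N\<close> with the larger constant \<open>a\<close>.  The chart
that turns \<open>L\<close> into \<open>(norm u)\<^sup>2 - (norm v)\<^sup>2\<close> rescales \<open>M\<close> and the fibres parallel to \<open>N\<close> one after
the other.

\<^item> If \<open>norm u\<close> is large, \<open>v \<mapsto> L (u + v)\<close> is uniformly concave on \<open>N\<close>, so it has exactly one maximum
point \<open>h u\<close>.  A maximising sequence is Cauchy by uniform concavity, and the maximum \<open>J u\<close> and its
position \<open>h u\<close> depend continuously on \<open>u\<close> (\<open>fiber_maximum\<close>, \<open>continuous_on_J\<close>, \<open>continuous_on_h\<close>).

\<^item> \<open>J\<close> increases strictly along every ray of \<open>M\<close> and is squeezed between two multiples of
\<open>(norm u)\<^sup>2\<close>.  For the monotonicity one need not know where the maximum sits: moving a point from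
\<open>u + v\<close> to \<open>t u + v/t\<close> with \<open>t > 1\<close> raises \<open>L\<close>, whatever \<open>v\<close> is (\<open>L_hyperbolic_growth\<close>).  Hence the
equation \<open>J (\<sigma> e) = (norm u)\<^sup>2\<close> on the ray through \<open>u\<close> has exactly one solution.

\<^item> On the fibre over \<open>u\<close>, \<open>L\<close> falls strictly and without bound along every ray that starts at \<open>h u\<close>,
so the equation \<open>J u - L (u + h u + \<sigma> v) = (norm v)\<^sup>2\<close> has exactly one solution as well.

Roots of strictly monotone equations depend continuously on parameters, and the inverse of the chart
is an explicit formula in \<open>J\<close> and \<open>h\<close>; this gives the homeomorphism, and the bounds on the
\<open>M\<close>-component are the bounds on \<open>J\<close>.  The case where \<open>N\<close> is trivial is the special case in which \<open>M\<close> is the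
whole space.

What remains is to derive this geometric picture from the hypotheses.  Since \<open>B\<close> is a compact
perturbation of a coercive operator, its spectrum below some positive number consists of eigenvalues;
a maximal orthonormal set of negative eigenvectors is finite, and \<open>B\<close> is coercive on its orthogonal
complement because the kernel is trivial (\<open>finite_negative_eigenbasis\<close>).  The two parts of this splitting
are the spectral subspaces (\<open>spectral_splitting\<close>).  The gradient bound is integrated along segments
between points of the dense subspace and passes to the whole space by continuity (\<open>L_segment\<close>).  The
concavity comes from the second derivative \<open>B x\<close>: it converges strongly to \<open>B\<close>, hence uniformly on the
finite-dimensional \<open>N\<close>, and \<open>N\<close> lies in the dense subspace because it is spanned by eigenvectors with
negative eigenvalues (\<open>saddle_structure\<close>).\<close>

section \<open>Compact perturbations of coercive operators\<close>

lemma compact_op_convergent_subseq: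
  fixes Q :: "'a::real_normed_vector \<Rightarrow>\<^sub>L 'b::real_normed_vector"
  assumes "compact_op Q" and "\<And>n::nat. norm (x n) \<le> 1"
  obtains l r where "strict_mono (r :: nat \<Rightarrow> nat)" "(\<lambda>n. Q (x (r n))) \<longlonglongrightarrow> l"
proof -
  let ?K = "closure (blinfun_apply Q ` cball 0 1)"
  have "Q (x n) \<in> ?K" for n
    using assms(2)[of n] by (intro subsetD[OF closure_subset] imageI) simp
  moreover have "seq_compact ?K"
    using assms(1) unfolding compact_op_def compact_eq_seq_compact_metric .
  ultimately obtain l r where "strict_mono (r :: nat \<Rightarrow> nat)" "((\<lambda>n. Q (x n)) \<circ> r) \<longlonglongrightarrow> l"
    unfolding seq_compact_def by metis
  then show ?thesis using that by (simp add: comp_def)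
qed

text \<open>The Cauchy--Schwarz inequality for the form of \<open>T\<close> in quantitative shape.  It follows by evaluating
the nonnegative form at \<open>u - T u / c\<close>, the point to which a gradient step leads.\<close>

lemma nonneg_form_bounds_operator:
  fixes T :: "'h::real_inner \<Rightarrow>\<^sub>L 'h"
  assumes sa: "self_adjoint T" and S: "subspace S" "blinfun_apply T ` S \<subseteq> S"
    and nonneg: "\<And>u. u \<in> S \<Longrightarrow> 0 \<le> inner (T u) u"
    and upper: "\<And>u. u \<in> S \<Longrightarrow> inner (T u) u \<le> c * (norm u)\<^sup>2"
    and c: "c > 0" and u: "u \<in> S"
  shows "(norm (T u))\<^sup>2 \<le> c * inner (T u) u"
proof -
  have Tu: "T u \<in> S" using S u by auto
  define w where "w = u - (1/c) *\<^sub>R T u"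
  have w: "w \<in> S" unfolding w_def using S u Tu by (simp add: subspace_diff subspace_scale)
  have sym: "inner (T (T u)) u = (norm (T u))\<^sup>2"
    using sa unfolding self_adjoint_def by (simp add: power2_norm_eq_inner)
  have "inner (T w) w = inner (T u) u - (2/c) * (norm (T u))\<^sup>2 + (1/c)\<^sup>2 * inner (T (T u)) (T u)"
  proof -
    have "inner (T w) w = inner (T u) u - (1/c) * inner (T u) (T u) - (1/c) * inner (T (T u)) u
        + (1/c) * ((1/c) * inner (T (T u)) (T u))"
      unfolding w_def
      by (simp only: blinfun.diff_right blinfun.scaleR_right inner_diff_left inner_diff_right
          inner_scaleR_left inner_scaleR_right) (simp only: algebra_simps)
    then show ?thesis unfolding power2_norm_eq_inner using sym[unfolded power2_norm_eq_inner]
      by (simp add: power2_eq_square)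
  qed
  also have "\<dots> \<le> inner (T u) u - (2/c) * (norm (T u))\<^sup>2 + (1/c)\<^sup>2 * (c * (norm (T u))\<^sup>2)"
    using upper[OF Tu] by (intro add_left_mono mult_left_mono) auto
  also have "\<dots> = inner (T u) u - (norm (T u))\<^sup>2 / c"
    using c by (simp add: power2_eq_square field_simps)
  finally have "(norm (T u))\<^sup>2 / c \<le> inner (T u) u" using nonneg[OF w] by linarith
  then show ?thesis using c by (simp add: field_simps)
qed

lemma abs_form_le_norm:
  fixes T :: "'h::real_inner \<Rightarrow>\<^sub>L 'h"
  shows "\<bar>inner (T u) u\<bar> \<le> norm T * (norm u)\<^sup>2"
proof -
  have "\<bar>inner (T u) u\<bar> \<le> norm (T u) * norm u" by (rule Cauchy_Schwarz_ineq2)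
  also have "\<dots> \<le> (norm T * norm u) * norm u" by (intro mult_right_mono norm_blinfun) auto
  finally show ?thesis by (simp add: power2_eq_square mult.assoc)
qed

text \<open>Let \<open>m\<close> be the infimum of the form on the unit sphere of \<open>S\<close>.  If \<open>m \<le> 0\<close>, a minimising sequence
consists of approximate eigenvectors: \<open>B u - m u\<close> tends to \<open>0\<close>.  Along a subsequence \<open>Q u\<close> converges,
hence so does \<open>(P - m) u\<close>, and as \<open>P - m\<close> is coercive the sequence itself converges in norm, to
an eigenvector.\<close>

lemma coercive_or_nonpos_eigenvector:
  fixes B P Q :: "'h::{real_inner,complete_space} \<Rightarrow>\<^sub>L 'h"
  assumes B: "B = P + Q" "self_adjoint B" and C0: "C0 > 0"
    and P: "\<And>u. C0 * (norm u)\<^sup>2 \<le> inner (P u) u" and Q: "compact_op Q"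
    and S: "subspace S" "closed S" "blinfun_apply B ` S \<subseteq> S"
    and ncoer: "\<not> (\<exists>k>0. \<forall>u\<in>S. k * (norm u)\<^sup>2 \<le> inner (B u) u)"
  obtains m u where "m \<le> 0" "u \<in> S" "norm u = 1" "B u = m *\<^sub>R u"
proof -
  define R where "R = {inner (B u) u | u. u \<in> S \<and> norm u = 1}"
  have "\<exists>u\<in>S. u \<noteq> 0"
  proof (rule ccontr)
    assume "\<not> ?thesis"
    then have "\<forall>u\<in>S. 1 * (norm u)\<^sup>2 \<le> inner (B u) u" by auto
    then show False using ncoer zero_less_one by blast
  qed
  then obtain u0 where u0: "u0 \<in> S" "u0 \<noteq> 0" by blast
  have "inner (B (u0 /\<^sub>R norm u0)) (u0 /\<^sub>R norm u0) \<in> R"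
    unfolding R_def using u0 S(1) by (auto intro!: exI[of _ "u0 /\<^sub>R norm u0"] subspace_scale)
  then have Rne: "R \<noteq> {}" by blast
  have "bdd_below R"
  proof (rule bdd_belowI[of _ "- norm B"])
    fix t assume "t \<in> R"
    then obtain u where "u \<in> S" "norm u = 1" "t = inner (B u) u" unfolding R_def by blast
    then show "- norm B \<le> t" using abs_form_le_norm[of B u] by auto
  qed
  define m where "m = Inf R"
  have m_le: "m * (norm u)\<^sup>2 \<le> inner (B u) u" if "u \<in> S" for u
  proof (cases "u = 0")
    case False
    have "inner (B (u /\<^sub>R norm u)) (u /\<^sub>R norm u) \<in> R"
      unfolding R_def using that False S(1) by (auto intro!: exI[of _ "u /\<^sub>R norm u"] subspace_scale)
    then have "m \<le> inner (B (u /\<^sub>R norm u)) (u /\<^sub>R norm u)"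
      unfolding m_def using \<open>bdd_below R\<close> by (rule cInf_lower)
    then have "m \<le> inner (B u) u / (norm u)\<^sup>2"
      by (simp add: blinfun.scaleR_right power2_eq_square field_simps)
    then show ?thesis using False by (simp add: field_simps)
  qed simp
  have m0: "m \<le> 0" using ncoer m_le by (meson not_le)
  have "\<exists>u. u \<in> S \<and> norm u = 1 \<and> inner (B u) u < m + 1 / real (Suc n)" for n
  proof -
    have "Inf R < m + 1 / real (Suc n)" unfolding m_def by simp
    from cInf_lessD[OF Rne this] show ?thesis unfolding R_def by blast
  qed
  then obtain u where u: "\<And>n. u n \<in> S" "\<And>n. norm (u n) = 1"
    "\<And>n. inner (B (u n)) (u n) < m + 1 / real (Suc n)" by metis
  \<comment> \<open>\<open>T\<close> is nonnegative on \<open>S\<close> and its form tends to \<open>0\<close> along \<open>u\<close>, hence so does \<open>T u\<close>.\<close>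
  define T where "T = B - m *\<^sub>R id_blinfun"
  have T: "T x = B x - m *\<^sub>R x" for x unfolding T_def by (simp add: blinfun.bilinear_simps)
  have saT: "self_adjoint T"
    using B(2) unfolding self_adjoint_def by (simp add: T inner_diff_left inner_diff_right)
  have TS: "blinfun_apply T ` S \<subseteq> S"
    using S by (auto simp: T image_subset_iff intro!: subspace_diff subspace_scale)
  have Tform: "inner (T x) x = inner (B x) x - m * (norm x)\<^sup>2" for x
    by (simp add: T inner_diff_left power2_norm_eq_inner)
  define c where "c = norm T + 1"
  have Tsq: "(norm (T (u n)))\<^sup>2 \<le> c * inner (T (u n)) (u n)" for n
  proof (rule nonneg_form_bounds_operator[OF saT S(1) TS _ _ _ u(1)])
    show "0 \<le> inner (T x) x" if "x \<in> S" for x using m_le[OF that] Tform by simp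
    show "inner (T x) x \<le> c * (norm x)\<^sup>2" if "x \<in> S" for x
      using abs_form_le_norm[of T x] zero_le_power2[of "norm x"] unfolding c_def distrib_right by linarith
    show "0 < c" unfolding c_def using norm_ge_zero[of T] by linarith
  qed
  have "(\<lambda>n. (norm (T (u n)))\<^sup>2) \<longlonglongrightarrow> 0"
  proof (rule tendsto_sandwich)
    show "\<forall>\<^sub>F n in sequentially. (0::real) \<le> (norm (T (u n)))\<^sup>2" by simp
    have "(norm (T (u n)))\<^sup>2 \<le> c * (1 / real (Suc n))" for n
    proof -
      have "c * inner (T (u n)) (u n) \<le> c * (1 / real (Suc n))"
        using u(3)[of n] unfolding c_def Tform u(2)
        by (intro mult_left_mono) (auto simp: add_nonneg_nonneg)
      then show ?thesis using Tsq[of n] by linarith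
    qed
    then show "\<forall>\<^sub>F n in sequentially. (norm (T (u n)))\<^sup>2 \<le> c * (1 / real (Suc n))" by simp
    show "(\<lambda>n. c * (1 / real (Suc n))) \<longlonglongrightarrow> 0"
      using tendsto_mult_right_zero[OF LIMSEQ_inverse_real_of_nat, of c] by (simp add: field_simps)
  qed simp
  then have Tu0: "(\<lambda>n. T (u n)) \<longlonglongrightarrow> 0"
    by (simp add: tendsto_norm_zero_iff)
  obtain l r where r: "strict_mono r" "(\<lambda>n. Q (u (r n))) \<longlonglongrightarrow> l"
    using compact_op_convergent_subseq[OF Q, of u] u(2) by (metis order_refl)
  define v where "v = (\<lambda>n. P (u (r n)) - m *\<^sub>R u (r n))"
  have "(\<lambda>n. T (u (r n)) - Q (u (r n))) \<longlonglongrightarrow> 0 - l"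
    using LIMSEQ_subseq_LIMSEQ[OF Tu0 r(1)] r(2) by (intro tendsto_diff) (auto simp: comp_def)
  moreover have "(\<lambda>n. T (u (r n)) - Q (u (r n))) = v"
    unfolding v_def T by (auto simp: B(1) blinfun.add_left)
  ultimately have "Cauchy v" using LIMSEQ_imp_Cauchy by metis
  have vdiff: "C0 * norm (u (r i) - u (r k)) \<le> norm (v i - v k)" for i k
  proof -
    define d where "d = u (r i) - u (r k)"
    have "C0 * (norm d)\<^sup>2 \<le> inner (P d) d - m * (norm d)\<^sup>2"
      using P[of d] mult_nonneg_nonneg[of "-m" "(norm d)\<^sup>2"] m0 by simp
    also have "\<dots> = inner (v i - v k) d"
      unfolding v_def d_def
      by (simp add: blinfun.diff_right inner_diff_left inner_diff_right power2_norm_eq_inner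
          algebra_simps)
    also have "\<dots> \<le> norm (v i - v k) * norm d" by (rule norm_cauchy_schwarz)
    finally show ?thesis unfolding d_def[symmetric]
      by (cases "d = 0") (simp_all add: power2_eq_square)
  qed
  have "Cauchy (\<lambda>n. u (r n))"
  proof (rule metric_CauchyI)
    fix e :: real assume "e > 0"
    then obtain M where M: "\<And>i k. i \<ge> M \<Longrightarrow> k \<ge> M \<Longrightarrow> dist (v i) (v k) < C0 * e"
      using \<open>Cauchy v\<close> C0 unfolding Cauchy_def by (metis mult_pos_pos)
    have "dist (u (r i)) (u (r k)) < e" if "i \<ge> M" "k \<ge> M" for i k
    proof -
      have "C0 * norm (u (r i) - u (r k)) < C0 * e"
        using vdiff[of i k] M[OF that] unfolding dist_norm by linarith
      then show ?thesis using C0 by (simp add: dist_norm)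
    qed
    then show "\<exists>M. \<forall>i\<ge>M. \<forall>k\<ge>M. dist (u (r i)) (u (r k)) < e" by blast
  qed
  then obtain z where z: "(\<lambda>n. u (r n)) \<longlonglongrightarrow> z" using Cauchy_convergent_iff convergent_def by blast
  have zS: "z \<in> S" using closed_sequentially[OF S(2) _ z] u(1) by blast
  have "(\<lambda>n. norm (u (r n))) \<longlonglongrightarrow> norm z" using z by (rule tendsto_norm)
  then have z1: "norm z = 1" by (simp add: u(2) LIMSEQ_const_iff)
  have "(\<lambda>n. T (u (r n))) \<longlonglongrightarrow> T z" by (intro blinfun.tendsto tendsto_const z)
  moreover have "(\<lambda>n. T (u (r n))) \<longlonglongrightarrow> 0"
    using LIMSEQ_subseq_LIMSEQ[OF Tu0 r(1)] by (simp add: comp_def)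
  ultimately have "T z = 0" by (rule LIMSEQ_unique)
  then have "B z = m *\<^sub>R z" by (simp add: T)
  with m0 zS z1 show ?thesis by (rule that)
qed

definition orthonormal_set :: "'h::real_inner set \<Rightarrow> bool" where
  "orthonormal_set E \<longleftrightarrow> (\<forall>e\<in>E. norm e = 1) \<and> pairwise orthogonal E"

text \<open>For two of the eigenvectors, with difference \<open>d\<close>, the form of \<open>B\<close> is nonpositive at \<open>d\<close>, so the
compact part \<open>Q\<close> has to compensate the coercive part \<open>P\<close> there: the images under \<open>Q\<close> stay apart, which
compactness forbids for infinitely many of them.\<close>

lemma finite_orthonormal_nonpos_eigenvectors:
  fixes B P Q :: "'h::real_inner \<Rightarrow>\<^sub>L 'h"
  assumes B: "B = P + Q" and C0: "C0 > 0"
    and P: "\<And>u. C0 * (norm u)\<^sup>2 \<le> inner (P u) u" and Q: "compact_op Q"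
    and E: "orthonormal_set E" "\<And>e. e \<in> E \<Longrightarrow> \<exists>c\<le>0. B e = c *\<^sub>R e"
  shows "finite E"
proof (rule ccontr)
  assume "infinite E"
  then obtain f :: "nat \<Rightarrow> 'h" where f: "inj f" "range f \<subseteq> E"
    using infinite_countable_subset by blast
  have fE: "f n \<in> E" for n using f by blast
  have n1: "norm (f n) = 1" for n using E fE unfolding orthonormal_set_def by blast
  have orth: "inner (f i) (f k) = 0" if "i \<noteq> k" for i k
    using E(1) fE[of i] fE[of k] that f(1)
    unfolding orthonormal_set_def pairwise_def orthogonal_def by (metis injD)
  obtain l r where r: "strict_mono r" "(\<lambda>n. Q (f (r n))) \<longlonglongrightarrow> l"
    using compact_op_convergent_subseq[OF Q, of f] n1 by (metis order_refl)
  have far: "C0 \<le> norm (Q (f i) - Q (f k))" if ik: "i \<noteq> k" for i k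
  proof -
    obtain c c' where c: "c \<le> 0" "B (f i) = c *\<^sub>R f i" "c' \<le> 0" "B (f k) = c' *\<^sub>R f k"
      using E(2) fE by metis
    define d where "d = f i - f k"
    have d2: "(norm d)\<^sup>2 = 2"
      unfolding d_def power2_norm_eq_inner
      using orth[OF ik] n1[of i] n1[of k]
      by (simp add: inner_diff_left inner_diff_right inner_commute norm_eq_sqrt_inner)
    have "inner (B d) d = c + c'"
      unfolding d_def using orth[OF ik] n1[of i] n1[of k] c
      by (simp add: blinfun.diff_right inner_diff_left inner_diff_right inner_commute
          norm_eq_sqrt_inner)
    then have "inner (P d) d + inner (Q d) d \<le> 0"
      using c by (simp add: B blinfun.add_left inner_add_left)
    then have "C0 * (norm d)\<^sup>2 \<le> \<bar>inner (Q d) d\<bar>" using P[of d] by linarith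
    also have "\<dots> \<le> norm (Q d) * norm d" by (rule Cauchy_Schwarz_ineq2)
    finally have "C0 * norm d \<le> norm (Q d)" using d2
      by (cases "d = 0") (auto simp: power2_eq_square)
    moreover have "1 \<le> norm d"
      using d2 by (metis norm_ge_zero one_le_numeral power2_le_imp_le power_one)
    ultimately have "C0 \<le> norm (Q d)" using C0 mult_left_mono[of 1 "norm d" C0] by linarith
    then show ?thesis unfolding d_def by (simp add: blinfun.diff_right)
  qed
  have "Cauchy (\<lambda>n. Q (f (r n)))" using r(2) LIMSEQ_imp_Cauchy by blast
  then obtain M where "\<And>i k. i \<ge> M \<Longrightarrow> k \<ge> M \<Longrightarrow> dist (Q (f (r i))) (Q (f (r k))) < C0"
    using C0 unfolding Cauchy_def by blast
  from this[of M "Suc M"] far[of "r M" "r (Suc M)"] show False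
    using r(1) by (simp add: dist_norm strict_mono_eq)
qed

lemma maximal_orthonormal_set:
  fixes X :: "'h::real_inner set"
  obtains E where "E \<subseteq> X" "orthonormal_set E"
    "\<And>e. e \<in> X \<Longrightarrow> norm e = 1 \<Longrightarrow> \<exists>f\<in>E. inner e f \<noteq> 0"
proof -
  define A where "A = {E. E \<subseteq> X \<and> orthonormal_set E}"
  have "\<exists>M\<in>A. \<forall>Y\<in>A. M \<subseteq> Y \<longrightarrow> Y = M"
  proof (rule subset_Zorn')
    fix C assume C: "subset.chain A C"
    then have CA: "C \<subseteq> A" and ch: "chain\<^sub>\<subseteq> C"
      unfolding subset.chain_def chain_subset_def by auto
    have "pairwise orthogonal (\<Union>C)"
      using CA by (intro pairwise_chain_Union[OF _ ch]) (auto simp: A_def orthonormal_set_def)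
    then show "\<Union>C \<in> A" using CA unfolding A_def orthonormal_set_def by blast
  qed
  then obtain E where E: "E \<in> A" "\<And>Y. Y \<in> A \<Longrightarrow> E \<subseteq> Y \<Longrightarrow> Y = E" by blast
  have "\<exists>f\<in>E. inner e f \<noteq> 0" if e: "e \<in> X" "norm e = 1" for e
  proof (rule ccontr)
    assume "\<not> ?thesis"
    then have orth: "\<forall>f\<in>E. inner e f = 0" by blast
    then have "insert e E \<in> A"
      using E(1) e unfolding A_def orthonormal_set_def
      by (auto simp: inner_commute pairwise_insert orthogonal_def)
    then have "e \<in> E" using E(2) by blast
    then show False using orth e(2) by auto
  qed
  then show ?thesis using E(1) that unfolding A_def by blast
qed

text \<open>If the form were not coercive on the orthogonal complement of a maximal set of negative
eigenvectors, that complement would contain an eigenvector with eigenvalue at most \<open>0\<close>.  Zero is excluded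
by the trivial kernel and a negative eigenvalue by maximality.\<close>

lemma finite_negative_eigenbasis:
  fixes B P Q :: "'h::{real_inner,complete_space} \<Rightarrow>\<^sub>L 'h"
  assumes B: "B = P + Q" "self_adjoint B" and C0: "C0 > 0"
    and P: "\<And>u. C0 * (norm u)\<^sup>2 \<le> inner (P u) u" and Q: "compact_op Q"
    and ker: "\<And>u. B u = 0 \<Longrightarrow> u = 0"
  obtains E k where "finite E" "orthonormal_set E"
    "\<And>e. e \<in> E \<Longrightarrow> \<exists>c<0. B e = c *\<^sub>R e"
    "k > 0" "\<And>u. (\<forall>e\<in>E. inner u e = 0) \<Longrightarrow> k * (norm u)\<^sup>2 \<le> inner (B u) u"
proof -
  obtain E where E: "E \<subseteq> {u. \<exists>c<0. B u = c *\<^sub>R u}" "orthonormal_set E"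
    and max: "\<And>e. e \<in> {u. \<exists>c<0. B u = c *\<^sub>R u} \<Longrightarrow> norm e = 1 \<Longrightarrow> \<exists>f\<in>E. inner e f \<noteq> 0"
    using maximal_orthonormal_set by blast
  have "finite E"
    using E by (intro finite_orthonormal_nonpos_eigenvectors[OF B(1) C0 P Q]) (auto intro: less_imp_le)
  define S where "S = {u. \<forall>e\<in>E. inner u e = 0}"
  have "subspace S" unfolding S_def subspace_def by (auto simp: inner_add_left)
  moreover have "closed S"
  proof -
    have "S = (\<Inter>e\<in>E. {u. inner u e = 0})" unfolding S_def by auto
    moreover have "closed {u. inner u e = 0}" for e :: 'h
      by (intro closed_Collect_eq continuous_intros)
    ultimately show ?thesis by auto
  qed
  moreover have "blinfun_apply B ` S \<subseteq> S"
  proof -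
    have "inner (B u) e = 0" if ue: "u \<in> S" "e \<in> E" for u e
    proof -
      obtain c where "B e = c *\<^sub>R e" using E(1) ue(2) by auto
      then show ?thesis using B(2) ue unfolding self_adjoint_def S_def by simp
    qed
    then show ?thesis unfolding S_def by auto
  qed
  ultimately have "\<exists>k>0. \<forall>u\<in>S. k * (norm u)\<^sup>2 \<le> inner (B u) u"
  proof (rule_tac ccontr)
    assume S: "subspace S" "closed S" "blinfun_apply B ` S \<subseteq> S"
    assume "\<not> ?thesis"
    then obtain m u where u: "m \<le> 0" "u \<in> S" "norm u = 1" "B u = m *\<^sub>R u"
      using coercive_or_nonpos_eigenvector[OF B C0 P Q S] by blast
    have "m \<noteq> 0" using ker[of u] u by auto
    then have "\<exists>f\<in>E. inner u f \<noteq> 0" using max[of u] u by force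
    then show False using u(2) unfolding S_def by blast
  qed
  then show ?thesis using that \<open>finite E\<close> E unfolding S_def by blast
qed

text \<open>Power iteration.  For large \<open>K\<close> the operator \<open>K - B\<close> stretches \<open>N\<close> by at least \<open>K\<close> and \<open>M\<close> by at most
\<open>K - k\<close>.  If \<open>n \<noteq> 0\<close>, the iterates of \<open>m + n\<close>, which all lie in \<open>S\<close>, are eventually dominated by their
component in \<open>N\<close>, where the form is negative.\<close>

lemma invariant_subspace_avoids_negative_part:
  fixes B :: "'h::real_inner \<Rightarrow>\<^sub>L 'h"
  assumes sa: "self_adjoint B"
    and M: "subspace M" "blinfun_apply B ` M \<subseteq> M" "k > 0"
      "\<And>u. u \<in> M \<Longrightarrow> k * (norm u)\<^sup>2 \<le> inner (B u) u"
    and N: "subspace N" "blinfun_apply B ` N \<subseteq> N" "c > 0"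
      "\<And>u. u \<in> N \<Longrightarrow> inner (B u) u \<le> - c * (norm u)\<^sup>2"
    and orth: "\<And>u v. u \<in> M \<Longrightarrow> v \<in> N \<Longrightarrow> inner u v = 0"
    and S: "subspace S" "blinfun_apply B ` S \<subseteq> S"
      "\<And>u. u \<in> S \<Longrightarrow> u \<noteq> 0 \<Longrightarrow> inner (B u) u > 0"
    and s: "m + n \<in> S" "m \<in> M" "n \<in> N"
  shows "n = 0"
proof (rule ccontr)
  assume n0: "n \<noteq> 0"
  \<comment> \<open>Large enough for the form of \<open>K - B\<close> to be nonnegative and for \<open>K - k\<close> to be positive.\<close>
  define K where "K = norm B + k + 1"
  have K: "K > k" "K > 0" unfolding K_def using M(3) norm_ge_zero[of B] by linarith+
  define T where "T = K *\<^sub>R id_blinfun - B"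
  have T: "T x = K *\<^sub>R x - B x" for x unfolding T_def by (simp add: blinfun.bilinear_simps)
  have Tinv: "T u \<in> Z" if "subspace Z" "blinfun_apply B ` Z \<subseteq> Z" "u \<in> Z" for Z u
    using that by (auto simp: T intro!: subspace_diff subspace_scale)
  have pow: "(blinfun_apply T ^^ i) u \<in> Z" if "subspace Z" "blinfun_apply B ` Z \<subseteq> Z" "u \<in> Z"
    for Z u i by (induction i) (use that Tinv in auto)
  have Tform: "inner (T x) x = K * (norm x)\<^sup>2 - inner (B x) x" for x
    by (simp add: T inner_diff_left power2_norm_eq_inner)
  have "self_adjoint T"
    using sa unfolding self_adjoint_def by (simp add: T inner_diff_left inner_diff_right)
  have contract: "norm (T u) \<le> (K - k) * norm u" if u: "u \<in> M" for u
  proof -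
    have up: "inner (T x) x \<le> (K - k) * (norm x)\<^sup>2" if "x \<in> M" for x
      using M(4)[OF that] by (simp add: Tform algebra_simps)
    have "(norm (T u))\<^sup>2 \<le> (K - k) * inner (T u) u"
    proof (rule nonneg_form_bounds_operator[OF \<open>self_adjoint T\<close> M(1) _ _ up _ u])
      show "blinfun_apply T ` M \<subseteq> M" using Tinv M by blast
      show "0 \<le> inner (T x) x" for x
      proof -
        have "norm B * (norm x)\<^sup>2 \<le> K * (norm x)\<^sup>2"
          unfolding K_def using M(3) by (intro mult_right_mono) auto
        then show ?thesis using abs_form_le_norm[of B x] by (simp add: Tform)
      qed
      show "0 < K - k" using K by simp
    qed auto
    also have "\<dots> \<le> (K - k) * ((K - k) * (norm u)\<^sup>2)"
      using up[OF u] K by (intro mult_left_mono) auto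
    also have "\<dots> = ((K - k) * norm u)\<^sup>2" by (simp add: power2_eq_square)
    finally show ?thesis by (rule power2_le_imp_le) (use K in simp)
  qed
  have expand: "K * norm u \<le> norm (T u)" if u: "u \<in> N" for u
  proof -
    have "K * (norm u)\<^sup>2 \<le> inner (T u) u" using N(4)[OF u] N(3) by (simp add: Tform)
      (smt (verit) mult_nonneg_nonneg zero_le_power2)
    also have "\<dots> \<le> norm (T u) * norm u" by (rule norm_cauchy_schwarz)
    finally show ?thesis by (cases "u = 0") (auto simp: power2_eq_square)
  qed
  define mi where "mi = (\<lambda>i. (blinfun_apply T ^^ i) m)"
  define ni where "ni = (\<lambda>i. (blinfun_apply T ^^ i) n)"
  have mi: "mi i \<in> M" and ni: "ni i \<in> N" for i
    unfolding mi_def ni_def using pow M N s by auto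
  have bm: "norm (mi i) \<le> (K - k) ^ i * norm m" for i
  proof (induction i)
    case (Suc i)
    have "norm (mi (Suc i)) \<le> (K - k) * norm (mi i)" using contract[OF mi] by (simp add: mi_def)
    also have "\<dots> \<le> (K - k) * ((K - k) ^ i * norm m)"
      using Suc K by (intro mult_left_mono) auto
    finally show ?case by simp
  qed (simp add: mi_def)
  have bn: "K ^ i * norm n \<le> norm (ni i)" for i
  proof (induction i)
    case (Suc i)
    have "K * (K ^ i * norm n) \<le> K * norm (ni i)" using Suc K by (intro mult_left_mono) auto
    also have "\<dots> \<le> norm (ni (Suc i))" using expand[OF ni] by (simp add: ni_def)
    finally show ?case by simp
  qed (simp add: ni_def)
  have sum: "mi i + ni i = (blinfun_apply T ^^ i) (m + n)" for i
    unfolding mi_def ni_def by (induction i) (simp_all add: blinfun.add_right[symmetric])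
  have pos: "c * (norm (ni i))\<^sup>2 < norm B * (norm (mi i))\<^sup>2" for i
  proof -
    have "mi i + ni i \<in> S" unfolding sum using pow S s by auto
    moreover have "ni i \<noteq> 0"
    proof -
      have "0 < K ^ i * norm n" using n0 K by simp
      then have "0 < norm (ni i)" using bn[of i] by linarith
      then show ?thesis by simp
    qed
    then have "mi i + ni i \<noteq> 0"
    proof -
      have "inner (mi i + ni i) (ni i) = inner (ni i) (ni i)"
        using orth[OF mi[of i] ni[of i]] by (simp add: inner_add_left)
      then show ?thesis using \<open>ni i \<noteq> 0\<close> by (metis inner_eq_zero_iff inner_zero_left)
    qed
    ultimately have "0 < inner (B (mi i + ni i)) (mi i + ni i)" using S(3) by blast
    also have "\<dots> = inner (B (mi i)) (mi i) + inner (B (ni i)) (ni i)"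
    proof -
      have "B (mi i) \<in> M" "B (ni i) \<in> N" using M N mi ni by blast+
      then show ?thesis using orth mi ni
        by (simp add: blinfun.add_right inner_add_left inner_add_right inner_commute[of "ni i"]
            inner_commute[of "B (ni i)" "mi i"])
    qed
    finally show ?thesis using abs_form_le_norm[of B "mi i"] N(4)[OF ni[of i]] by linarith
  qed
  define q where "q = ((K - k) / K)\<^sup>2"
  have q: "0 \<le> q" "q < 1"
    unfolding q_def using K M(3) by (auto simp: abs_square_less_1)
  have "c * (norm n)\<^sup>2 \<le> norm B * (norm m)\<^sup>2 * q ^ i" for i
  proof -
    have "(K ^ i)\<^sup>2 * (c * (norm n)\<^sup>2) = c * (K ^ i * norm n)\<^sup>2" by (simp add: power_mult_distrib)
    also have "\<dots> \<le> c * (norm (ni i))\<^sup>2"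
      using bn[of i] K N(3) by (intro mult_left_mono power_mono) auto
    also have "\<dots> \<le> norm B * (norm (mi i))\<^sup>2" using pos[of i] by simp
    also have "\<dots> \<le> norm B * ((K - k) ^ i * norm m)\<^sup>2"
      using bm[of i] by (intro mult_left_mono power_mono) auto
    also have "\<dots> = (K ^ i)\<^sup>2 * (norm B * (norm m)\<^sup>2 * q ^ i)"
      unfolding q_def using K
      by (simp add: power_mult_distrib power_divide power_mult[symmetric] mult.commute)
    finally show ?thesis using K by simp
  qed
  moreover have "(\<lambda>i. norm B * (norm m)\<^sup>2 * q ^ i) \<longlonglongrightarrow> 0"
    using q by (intro tendsto_mult_right_zero LIMSEQ_power_zero) auto
  ultimately have "c * (norm n)\<^sup>2 \<le> 0"
    by (intro LIMSEQ_le_const) auto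
  then show False using n0 N(3) by (simp add: mult_le_0_iff)
qed

section \<open>The spectral splitting\<close>

definition orthonormal_expansion :: "'h::real_inner set \<Rightarrow> 'h \<Rightarrow> 'h" where
  "orthonormal_expansion E x = (\<Sum>e\<in>E. inner x e *\<^sub>R e)"

lemma bounded_linear_orthonormal_expansion: "bounded_linear (orthonormal_expansion E)"
  unfolding orthonormal_expansion_def
  by (intro bounded_linear_sum bounded_linear_scaleR_left[THEN bounded_linear_compose]
      bounded_linear_inner_left)

lemma orthonormal_expansion_in_span: "orthonormal_expansion E x \<in> span E"
  unfolding orthonormal_expansion_def by (intro span_sum span_scale span_base)

lemma inner_orthonormal_expansion:
  assumes "finite E" "orthonormal_set E" "e \<in> E"
  shows "inner (orthonormal_expansion E x) e = inner x e"
proof -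
  have "inner (inner x f *\<^sub>R f) e = (if f = e then inner x e else 0)" if "f \<in> E" for f
    using assms that unfolding orthonormal_set_def pairwise_def orthogonal_def
    by (auto simp: norm_eq_1)
  then have "inner (orthonormal_expansion E x) e = (\<Sum>f\<in>E. if f = e then inner x e else 0)"
    unfolding orthonormal_expansion_def inner_sum_left by (intro sum.cong) auto
  then show ?thesis using assms by simp
qed

lemma orth_to_span:
  assumes "\<forall>e\<in>E. inner x e = 0" "y \<in> span E"
  shows "inner x y = 0"
  using orthogonal_to_span[of y E x] assms by (auto simp: orthogonal_def)

lemma orthonormal_expansion_span:
  assumes "finite E" "orthonormal_set E" "x \<in> span E"
  shows "orthonormal_expansion E x = x"
proof -
  let ?d = "x - orthonormal_expansion E x"
  have "?d \<in> span E" using assms by (intro span_diff orthonormal_expansion_in_span)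
  moreover have "\<forall>e\<in>E. inner ?d e = 0"
    using inner_orthonormal_expansion[OF assms(1,2)] by (simp add: inner_diff_left)
  ultimately have "inner ?d ?d = 0" using orth_to_span by blast
  then show ?thesis by simp
qed

lemma closed_span_orthonormal:
  assumes "finite E" "orthonormal_set E"
  shows "closed (span E)"
proof -
  have "span E = {x. orthonormal_expansion E x = x}"
    using orthonormal_expansion_span[OF assms] orthonormal_expansion_in_span by (metis (lifting) Collect_cong Collect_mem_eq)
  moreover have "closed {x. orthonormal_expansion E x = x}"
    by (intro closed_Collect_eq continuous_intros
        linear_continuous_on[OF bounded_linear_orthonormal_expansion])
  ultimately show ?thesis by simp
qed

text \<open>In the eigenbasis the form is diagonal, and the largest of the finitely many eigenvalues is still
negative.\<close>

lemma negative_form_on_span: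
  fixes B :: "'h::real_inner \<Rightarrow>\<^sub>L 'h"
  assumes E: "finite E" "orthonormal_set E" "\<And>e. e \<in> E \<Longrightarrow> \<exists>c<0. B e = c *\<^sub>R e"
  obtains c where "c > 0" "\<And>u. u \<in> span E \<Longrightarrow> inner (B u) u \<le> - c * (norm u)\<^sup>2"
proof -
  obtain f where f: "\<And>e. e \<in> E \<Longrightarrow> f e < 0" "\<And>e. e \<in> E \<Longrightarrow> B e = f e *\<^sub>R e"
    using E(3) by metis
  define c where "c = Min (insert 1 ((\<lambda>e. - f e) ` E))"
  have c: "c > 0" "\<And>e. e \<in> E \<Longrightarrow> c \<le> - f e"
    unfolding c_def using E(1) f(1) by auto
  have "inner (B u) u \<le> - c * (norm u)\<^sup>2" if u: "u \<in> span E" for u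
  proof -
    have ue: "u = (\<Sum>e\<in>E. inner u e *\<^sub>R e)"
      using orthonormal_expansion_span[OF E(1,2) u] unfolding orthonormal_expansion_def by simp
    have "B u = (\<Sum>e\<in>E. inner u e *\<^sub>R B e)"
      by (subst ue) (simp add: blinfun.sum_right blinfun.scaleR_right)
    also have "\<dots> = (\<Sum>e\<in>E. (inner u e * f e) *\<^sub>R e)" using f(2) by (intro sum.cong) auto
    finally have "inner (B u) u = (\<Sum>e\<in>E. (inner u e * f e) * inner e u)"
      by (metis (no_types, lifting) inner_scaleR_left inner_sum_left sum.cong)
    then have Bu: "inner (B u) u = (\<Sum>e\<in>E. f e * (inner u e)\<^sup>2)"
      by (simp add: power2_eq_square inner_commute[of _ u] mult_ac)
    have "(norm u)\<^sup>2 = inner (\<Sum>e\<in>E. inner u e *\<^sub>R e) u"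
      using ue power2_norm_eq_inner[of u] by simp
    also have "\<dots> = (\<Sum>e\<in>E. (inner u e)\<^sup>2)"
      unfolding inner_sum_left by (simp add: power2_eq_square inner_commute[of _ u])
    finally have "- c * (norm u)\<^sup>2 = (\<Sum>e\<in>E. - c * (inner u e)\<^sup>2)" by (simp add: sum_distrib_left sum_negf)
    moreover have "(\<Sum>e\<in>E. f e * (inner u e)\<^sup>2) \<le> (\<Sum>e\<in>E. - c * (inner u e)\<^sup>2)"
      using c(2) by (intro sum_mono mult_right_mono) force+
    ultimately show ?thesis using Bu by simp
  qed
  then show ?thesis using that c(1) by blast
qed

text \<open>Applied to \<open>B\<close> and to \<open>- B\<close>, this identifies both spectral subspaces.\<close>

lemma pos_subspace_eqI:
  fixes B :: "'h::real_inner \<Rightarrow>\<^sub>L 'h"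
  assumes sa: "self_adjoint B"
    and M: "subspace M" "blinfun_apply B ` M \<subseteq> M" "k > 0"
      "\<And>u. u \<in> M \<Longrightarrow> k * (norm u)\<^sup>2 \<le> inner (B u) u"
    and N: "subspace N" "blinfun_apply B ` N \<subseteq> N" "c > 0"
      "\<And>u. u \<in> N \<Longrightarrow> inner (B u) u \<le> - c * (norm u)\<^sup>2"
    and orth: "\<And>u v. u \<in> M \<Longrightarrow> v \<in> N \<Longrightarrow> inner u v = 0"
    and dec: "\<And>x. \<exists>u\<in>M. \<exists>v\<in>N. x = u + v" and "closed M"
  shows "pos_subspace B = M"
proof
  have "u \<noteq> 0 \<Longrightarrow> inner (B u) u > 0" if "u \<in> M" for u
    using M(3) M(4)[OF that] by (smt (verit) mult_pos_pos zero_less_norm_iff zero_less_power)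
  then show "M \<subseteq> pos_subspace B" unfolding pos_subspace_def using M \<open>closed M\<close> by blast
  show "pos_subspace B \<subseteq> M"
  proof
    fix s assume "s \<in> pos_subspace B"
    then obtain S where S: "subspace S" "blinfun_apply B ` S \<subseteq> S"
      "\<And>u. u \<in> S \<Longrightarrow> u \<noteq> 0 \<Longrightarrow> inner (B u) u > 0" and sS: "s \<in> S"
      unfolding pos_subspace_def by blast
    obtain m n where mn: "m \<in> M" "n \<in> N" "s = m + n" using dec by blast
    have "n = 0"
      using invariant_subspace_avoids_negative_part[OF sa M N orth S _ mn(1,2)] sS mn(3) by blast
    then show "s \<in> M" using mn by simp
  qed
qed

lemma neg_subspace_eq_pos_subspace_uminus: "neg_subspace B = pos_subspace (- B)"
proof -
  have "blinfun_apply (- B) ` S \<subseteq> S \<longleftrightarrow> blinfun_apply B ` S \<subseteq> S" if "subspace S" for S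
  proof -
    have "- x \<in> S \<longleftrightarrow> x \<in> S" for x
      using subspace_neg[OF that, of x] subspace_neg[OF that, of "- x"] by auto
    then show ?thesis by (simp add: image_subset_iff blinfun.minus_left)
  qed
  then show ?thesis
    unfolding neg_subspace_def pos_subspace_def
    by (intro arg_cong[where f = Union] Collect_cong) (auto simp: blinfun.minus_left)
qed

lemma spectral_splitting:
  fixes B P Q :: "'h::{real_inner,complete_space} \<Rightarrow>\<^sub>L 'h"
  assumes B: "B = P + Q" "self_adjoint B" and C0: "C0 > 0"
    and P: "\<And>u. C0 * (norm u)\<^sup>2 \<le> inner (P u) u" and Q: "compact_op Q"
    and ker: "\<And>u. B u = 0 \<Longrightarrow> u = 0"
  obtains E where "finite E" "orthonormal_set E" "\<And>e. e \<in> E \<Longrightarrow> \<exists>c<0. B e = c *\<^sub>R e"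
    "pos_subspace B = {u. \<forall>e\<in>E. inner u e = 0}" "neg_subspace B = span E"
proof -
  obtain E k where E: "finite E" "orthonormal_set E" "\<And>e. e \<in> E \<Longrightarrow> \<exists>c<0. B e = c *\<^sub>R e"
    and k: "k > 0" "\<And>u. (\<forall>e\<in>E. inner u e = 0) \<Longrightarrow> k * (norm u)\<^sup>2 \<le> inner (B u) u"
    using finite_negative_eigenbasis[OF B C0 P Q ker] by blast
  obtain c where c: "c > 0" "\<And>u. u \<in> span E \<Longrightarrow> inner (B u) u \<le> - c * (norm u)\<^sup>2"
    using negative_form_on_span[OF E] by blast
  define M where "M = {u. \<forall>e\<in>E. inner u e = 0}"
  have Be: "inner (B u) e = inner u (B e)" for u e using B(2) unfolding self_adjoint_def by blast
  have M: "subspace M" "blinfun_apply B ` M \<subseteq> M"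
  proof -
    show "subspace M" unfolding M_def subspace_def by (auto simp: inner_add_left)
    have "inner (B u) e = 0" if ue: "u \<in> M" "e \<in> E" for u e
    proof -
      obtain d where "B e = d *\<^sub>R e" using E(3)[OF ue(2)] by blast
      then show ?thesis using ue unfolding Be M_def by simp
    qed
    then show "blinfun_apply B ` M \<subseteq> M" unfolding M_def by auto
  qed
  have "closed M"
  proof -
    have "M = (\<Inter>e\<in>E. {u. inner u e = 0})" unfolding M_def by auto
    moreover have "closed {u. inner u e = 0}" for e :: 'h
      by (intro closed_Collect_eq continuous_intros)
    ultimately show ?thesis by auto
  qed
  have N: "subspace (span E)" "blinfun_apply B ` span E \<subseteq> span E"
  proof -
    have "B u \<in> span E" if "u \<in> span E" for u
      using that
    proof (induction rule: span_induct_alt)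
      case (step c x y)
      obtain d where "B x = d *\<^sub>R x" using E(3)[OF step(1)] by blast
      then show ?case
        using step by (simp add: blinfun.add_right blinfun.scaleR_right span_add span_scale span_base)
    qed (simp add: span_zero)
    then show "blinfun_apply B ` span E \<subseteq> span E" by blast
  qed simp
  have kM: "k * (norm u)\<^sup>2 \<le> inner (B u) u" if "u \<in> M" for u using k(2) that unfolding M_def by blast
  have orth: "inner u v = 0" if "u \<in> M" "v \<in> span E" for u v
    using orth_to_span that unfolding M_def by blast
  have dec: "\<exists>u\<in>M. \<exists>v\<in>span E. x = u + v" for x
  proof (intro bexI)
    show "x = (x - orthonormal_expansion E x) + orthonormal_expansion E x" by simp
    show "x - orthonormal_expansion E x \<in> M"
      unfolding M_def using inner_orthonormal_expansion[OF E(1,2)] by (simp add: inner_diff_left)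
  qed (rule orthonormal_expansion_in_span)
  have "pos_subspace B = M"
    by (rule pos_subspace_eqI[OF B(2) M k(1) kM N c orth dec \<open>closed M\<close>])
  moreover have "pos_subspace (- B) = span E"
  proof (rule pos_subspace_eqI[where M = "span E" and N = M and k = c and c = k])
    show "self_adjoint (- B)" using B(2) unfolding self_adjoint_def by (simp add: blinfun.minus_left)
    show "blinfun_apply (- B) ` span E \<subseteq> span E"
      using N by (auto simp: blinfun.minus_left image_subset_iff intro!: span_neg)
    show "blinfun_apply (- B) ` M \<subseteq> M"
      using M by (auto simp: blinfun.minus_left image_subset_iff intro!: subspace_neg)
    show "c * (norm u)\<^sup>2 \<le> inner ((- B) u) u" if "u \<in> span E" for u
      using c(2)[OF that] by (simp add: blinfun.minus_left)
    show "inner ((- B) u) u \<le> - k * (norm u)\<^sup>2" if "u \<in> M" for u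
      using kM[OF that] by (simp add: blinfun.minus_left)
    show "inner u v = 0" if "u \<in> span E" "v \<in> M" for u v
      using orth[OF that(2,1)] by (simp add: inner_commute)
    show "\<exists>u\<in>span E. \<exists>v\<in>M. x = u + v" for x using dec[of x] by (metis add.commute)
    show "closed (span E)" by (rule closed_span_orthonormal[OF E(1,2)])
  qed (use N M k c in auto)
  ultimately show ?thesis
    using that[OF E] unfolding neg_subspace_eq_pos_subspace_uminus M_def by blast
qed

lemma orth_proj_eqI:
  assumes "subspace S" "y \<in> S" "\<And>w. w \<in> S \<Longrightarrow> inner (x - y) w = 0"
  shows "orth_proj S x = y"
  unfolding orth_proj_def
proof (rule the_equality)
  show "y \<in> S \<and> (\<forall>w\<in>S. inner (x - y) w = 0)" using assms by blast
  fix z assume z: "z \<in> S \<and> (\<forall>w\<in>S. inner (x - z) w = 0)"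
  then have "z - y \<in> S" using assms by (simp add: subspace_diff)
  then have "inner (x - y) (z - y) - inner (x - z) (z - y) = 0" using assms z by simp
  then have "inner (z - y) (z - y) = 0" by (simp add: inner_diff_left)
  then show "z = y" by simp
qed

lemma edim_zero_imp_trivial:
  assumes "edim S = 0"
  shows "S \<subseteq> {0}"
proof -
  obtain b where b: "finite b" "S \<subseteq> span b" and d: "dim S = 0"
    using assms unfolding edim_def by (auto simp: zero_enat_def split: if_splits)
  obtain B where B: "B \<subseteq> S" "independent B" "S \<subseteq> span B" "card B = dim S"
    using basis_exists by blast
  have "finite B" using independent_span_bound[OF b(1) B(2)] B(1) b(2) by blast
  then show ?thesis using B d by auto
qed

section \<open>Continuity of implicitly defined functions\<close>

text \<open>By strict monotonicity, that the root lies above or below a given number \<open>\<sigma>\<close> is a strict inequality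
for \<open>F y \<sigma>\<close>, and this persists for nearby parameters.\<close>

lemma continuous_on_monotone_root:
  fixes F :: "'a::topological_space \<Rightarrow> real \<Rightarrow> real"
  assumes root: "\<And>y. y \<in> D \<Longrightarrow> s y > k" "\<And>y. y \<in> D \<Longrightarrow> F y (s y) = c y"
    and cont: "\<And>\<sigma>. \<sigma> > k \<Longrightarrow> continuous_on D (\<lambda>y. F y \<sigma>)" "continuous_on D c"
    and mono: "\<And>y \<sigma> \<tau>. y \<in> D \<Longrightarrow> k < \<sigma> \<Longrightarrow> \<sigma> < \<tau> \<Longrightarrow> F y \<sigma> < F y \<tau>"
  shows "continuous_on D s"
  unfolding continuous_on_def
proof (intro ballI order_tendstoI)
  fix y \<sigma> assume y: "y \<in> D"
  have inD: "\<forall>\<^sub>F z in at y within D. z \<in> D" by (simp add: eventually_at_filter)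
  have lim: "((\<lambda>z. F z \<sigma> - c z) \<longlongrightarrow> F y \<sigma> - c y) (at y within D)" if "\<sigma> > k"
    using cont(1)[OF that] cont(2) y by (intro tendsto_diff) (auto simp: continuous_on_def)
  show "\<forall>\<^sub>F z in at y within D. \<sigma> < s z" if "\<sigma> < s y"
  proof (cases "\<sigma> > k")
    case True
    have "F y \<sigma> - c y < 0" using mono[OF y True that] root(2)[OF y] by simp
    from order_tendstoD(2)[OF lim[OF True] this] inD show ?thesis
    proof eventually_elim
      case (elim z)
      then show ?case using mono[of z "s z" \<sigma>] root[of z] by (cases "\<sigma> = s z"; force)
    qed
  next
    case False
    then have *: "\<sigma> < s z" if "z \<in> D" for z using root(1)[OF that] by linarith
    from inD show ?thesis by eventually_elim (rule *)
  qed
  show "\<forall>\<^sub>F z in at y within D. s z < \<sigma>" if "s y < \<sigma>"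
  proof -
    have k: "\<sigma> > k" using root(1)[OF y] that by linarith
    have "F y \<sigma> - c y > 0" using mono[OF y root(1)[OF y] that] root(2)[OF y] by simp
    from order_tendstoD(1)[OF lim[OF k] this] inD show ?thesis
    proof eventually_elim
      case (elim z)
      then show ?case using mono[of z \<sigma> "s z"] k root[of z] by (cases "\<sigma> = s z"; force)
    qed
  qed
qed

text \<open>For functions built from a direction that is undefined where \<open>w\<close> vanishes: there continuity comes
from the bound alone.\<close>

lemma continuous_on_scaleR_vanishing:
  fixes w :: "'a::topological_space \<Rightarrow> 'h::real_normed_vector"
  assumes w: "continuous_on S w" and f: "continuous_on {x \<in> S. w x \<noteq> 0} f"
    and bound: "\<And>x. x \<in> S \<Longrightarrow> norm (f x) \<le> g x" and g: "continuous_on S g"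
    and zero: "\<And>x. x \<in> S \<Longrightarrow> w x = 0 \<Longrightarrow> g x = (0::real)"
  shows "continuous_on S (f :: 'a \<Rightarrow> 'b::real_normed_vector)"
  unfolding continuous_on_def
proof
  fix x assume x: "x \<in> S"
  show "(f \<longlongrightarrow> f x) (at x within S)"
  proof (cases "w x = 0")
    case False
    have "\<forall>\<^sub>F y in at x within S. w y \<noteq> 0"
      using w x False unfolding continuous_on_def by (intro tendsto_imp_eventually_ne) auto
    then have "at x within S = at x within {x \<in> S. w x \<noteq> 0}"
      unfolding at_within_def filter_eq_iff eventually_inf_principal eventually_at_filter
      by (auto elim: eventually_elim2 eventually_mono)
    then show ?thesis using f x False by (simp add: continuous_on_def)
  next
    case True
    have "f x = 0" using bound[OF x] zero[OF x True] by simp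
    moreover have "(g \<longlongrightarrow> 0) (at x within S)"
      using g x zero[OF x True] unfolding continuous_on_def by auto
    then have "(f \<longlongrightarrow> 0) (at x within S)"
      by (rule Lim_null_comparison[rotated]) (auto simp: eventually_at_filter bound)
    ultimately show ?thesis by simp
  qed
qed

lemma sgn_sgn_vector: "sgn (sgn x) = sgn (x :: 'a::real_normed_vector)"
  by (cases "x = 0") (simp_all add: sgn_div_norm[of "sgn x"] norm_sgn)

lemma norm_scaleR_sgn: "norm x *\<^sub>R sgn x = (x :: 'a::real_normed_vector)"
  by (cases "x = 0") (simp_all add: sgn_div_norm)

lemma continuous_on_scaleR_sgn:
  fixes f :: "'z::topological_space \<Rightarrow> real" and w :: "'z \<Rightarrow> 'b::real_normed_vector"
  assumes "continuous_on S f" "continuous_on S w" "\<And>x. x \<in> S \<Longrightarrow> w x = 0 \<Longrightarrow> f x = 0"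
  shows "continuous_on S (\<lambda>x. f x *\<^sub>R sgn (w x))"
proof (rule continuous_on_scaleR_vanishing[where g = "\<lambda>x. \<bar>f x\<bar>", OF assms(2)])
  show "continuous_on {x \<in> S. w x \<noteq> 0} (\<lambda>x. f x *\<^sub>R sgn (w x))"
    by (intro continuous_intros continuous_on_sgn continuous_on_subset[OF assms(1)]
        continuous_on_subset[OF assms(2)]) auto
qed (use assms in \<open>auto simp: norm_sgn intro!: continuous_intros\<close>)

section \<open>Functions close to a quadratic saddle\<close>

text \<open>The geometric situation.  The projection \<open>p\<close> onto \<open>M\<close> is along \<open>N\<close>.  In \<open>L_segment\<close> the vector \<open>w\<close>
provides a half-space outside the ball of radius \<open>R\<close> that contains both end points, and therefore the
whole segment between them; in \<open>L_concave\<close> uniform concavity with modulus \<open>a\<close> is stated without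
derivatives.\<close>

locale saddle_at_infinity =
  fixes T :: "'h::{real_inner,complete_space} \<Rightarrow>\<^sub>L 'h"
    and M N :: "'h set" and p :: "'h \<Rightarrow> 'h" and L :: "'h \<Rightarrow> real" and a l R R1 :: real
  assumes sa: "self_adjoint T"
    and subspaces: "subspace M" "subspace N"
    and p: "bounded_linear p" "\<And>x. p x \<in> M" "\<And>x. x - p x \<in> N"
    and orth: "\<And>u v. u \<in> M \<Longrightarrow> v \<in> N \<Longrightarrow> inner u v = 0"
    and invM: "\<And>u. u \<in> M \<Longrightarrow> T u \<in> M"
    and T_pos: "\<And>u. u \<in> M \<Longrightarrow> 2 * a * (norm u)\<^sup>2 \<le> inner (T u) u"
    and T_neg: "\<And>v. v \<in> N \<Longrightarrow> inner (T v) v \<le> - 2 * a * (norm v)\<^sup>2"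
    and l: "0 < l" "l < a" and R: "0 < R" "R < R1"
    and L_cont: "continuous_on {x. R \<le> norm x} L"
    and L_bound: "\<And>x. R \<le> norm x \<Longrightarrow> \<bar>L x - 1/2 * inner (T x) x\<bar> \<le> l * (norm x)\<^sup>2"
    and L_segment: "\<And>x y w. norm w \<le> 1 \<Longrightarrow> R < inner x w \<Longrightarrow> R < inner y w \<Longrightarrow>
      \<bar>(L y - 1/2 * inner (T y) y) - (L x - 1/2 * inner (T x) x)\<bar>
        \<le> l * max (norm x) (norm y) * norm (y - x)"
    and L_concave: "\<And>u v w t. u \<in> M \<Longrightarrow> R1 \<le> norm u \<Longrightarrow> v \<in> N \<Longrightarrow> w \<in> N \<Longrightarrow> 0 \<le> t \<Longrightarrow> t \<le> 1 \<Longrightarrow>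
      (1 - t) * L (u + v) + t * L (u + w) + a/2 * (t * (1 - t)) * (norm (v - w))\<^sup>2
        \<le> L (u + ((1 - t) *\<^sub>R v + t *\<^sub>R w))"
begin

lemma R1_pos: "0 < R1" using R by linarith

lemma p_split: "p (u + v) = u" if "u \<in> M" "v \<in> N"
proof -
  have "(u + v - p (u + v)) - v \<in> N" using subspaces(2) p(3) that(2) by (rule subspace_diff)
  then have "u - p (u + v) \<in> N" by (simp add: algebra_simps)
  moreover have "u - p (u + v) \<in> M" using that p subspaces by (intro subspace_diff) auto
  ultimately have "inner (u - p (u + v)) (u - p (u + v)) = 0" using orth by blast
  then show ?thesis by simp
qed

lemma N_eq: "N = {x. p x = 0}"
proof -
  have "p v = 0" if "v \<in> N" for v using p_split[of 0 v] that subspaces(1) by (simp add: subspace_0)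
  moreover have "v \<in> N" if "p v = 0" for v using p(3)[of v] that by simp
  ultimately show ?thesis by blast
qed

lemma continuous_on_p [continuous_intros]:
  "continuous_on S f \<Longrightarrow> continuous_on S (\<lambda>x. p (f x))"
  using p(1) by (rule bounded_linear.continuous_on)

lemma closed_N: "closed N"
  unfolding N_eq by (intro closed_Collect_eq continuous_intros)

lemma pythagoras: "u \<in> M \<Longrightarrow> v \<in> N \<Longrightarrow> (norm (u + v))\<^sup>2 = (norm u)\<^sup>2 + (norm v)\<^sup>2"
  using orth[of u v] by (simp add: power2_norm_eq_inner inner_add_left inner_add_right inner_commute)

lemma norm_fiber: "norm u \<le> norm (u + v)" if "u \<in> M" "v \<in> N"
proof (rule power2_le_imp_le)
  show "(norm u)\<^sup>2 \<le> (norm (u + v))\<^sup>2" using pythagoras[OF that] by simp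
qed simp

lemma sgn_direction:
  assumes "u \<in> M" "u \<noteq> 0"
  shows "sgn u \<in> M" "norm (sgn u) = 1" "inner u (sgn u) = norm u"
proof -
  show "sgn u \<in> M" using assms subspaces by (simp add: sgn_div_norm subspace_scale)
  show "norm (sgn u) = 1" using assms by (simp add: norm_sgn)
  have "inner u (sgn u) = (norm u)\<^sup>2 / norm u"
    by (simp add: sgn_div_norm power2_norm_eq_inner divide_inverse mult.commute)
  then show "inner u (sgn u) = norm u" using assms by (simp add: power2_eq_square)
qed

definition b :: "'h \<Rightarrow> real" where "b x = 1/2 * inner (T x) x"

lemma b_split: "b (u + v) = b u + b v" if "u \<in> M" "v \<in> N"
proof -
  have "inner (T u) v = 0" using orth invM that by blast
  moreover have "inner (T v) u = inner (T u) v"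
    using sa unfolding self_adjoint_def by (simp add: inner_commute)
  ultimately show ?thesis by (simp add: b_def blinfun.add_right inner_add_left inner_add_right)
qed

lemma b_scale: "b (t *\<^sub>R x) = t\<^sup>2 * b x"
  by (simp add: b_def blinfun.scaleR_right power2_eq_square)

lemma continuous_on_b [continuous_intros]:
  "continuous_on S f \<Longrightarrow> continuous_on S (\<lambda>x. b (f x))"
  unfolding b_def by (intro continuous_intros)

lemma b_M: "u \<in> M \<Longrightarrow> a * (norm u)\<^sup>2 \<le> b u" using T_pos[of u] by (simp add: b_def)

lemma b_N: "v \<in> N \<Longrightarrow> b v \<le> - a * (norm v)\<^sup>2" using T_neg[of v] by (simp add: b_def)

definition C where "C = norm T / 2 + l"

lemma C_pos: "0 < C" unfolding C_def using l norm_ge_zero[of T] by linarith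

lemma b_upper: "b x \<le> norm T / 2 * (norm x)\<^sup>2"
proof -
  have "inner (T x) x \<le> norm (T x) * norm x" by (rule norm_cauchy_schwarz)
  also have "\<dots> \<le> (norm T * norm x) * norm x" by (intro mult_right_mono norm_blinfun) auto
  finally show ?thesis by (simp add: b_def power2_eq_square)
qed

text \<open>The coefficient of \<open>(norm v)\<^sup>2\<close> is negative because \<open>l < a\<close>: each fibre \<open>u + N\<close> carries \<open>L\<close> down to
minus infinity.\<close>

lemma L_upper: "L (u + v) \<le> C * (norm u)\<^sup>2 - (a - l) * (norm v)\<^sup>2"
  if "u \<in> M" "v \<in> N" "R \<le> norm u"
proof -
  have "R \<le> norm (u + v)" using norm_fiber that by (meson order_trans)
  then have "L (u + v) \<le> b u + b v + l * ((norm u)\<^sup>2 + (norm v)\<^sup>2)"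
    using L_bound[of "u + v"] b_split pythagoras that unfolding b_def[symmetric] by auto
  then show ?thesis using b_upper[of u] b_N[of v] that unfolding C_def by (simp add: algebra_simps)
qed

lemma L_lower: "(a - l) * (norm u)\<^sup>2 \<le> L u" if "u \<in> M" "R \<le> norm u"
  using L_bound[OF that(2)] b_M[OF that(1)] unfolding b_def[symmetric] left_diff_distrib by linarith

lemma L_line_continuous: "continuous_on S (\<lambda>x. L (f x + g x))"
  if "continuous_on S f" "continuous_on S g" "\<And>x. x \<in> S \<Longrightarrow> f x \<in> M \<and> R \<le> norm (f x) \<and> g x \<in> N"
proof (rule continuous_on_compose2[OF L_cont])
  show "continuous_on S (\<lambda>x. f x + g x)" by (intro continuous_intros that)
  show "(\<lambda>x. f x + g x) ` S \<subseteq> {x. R \<le> norm x}"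
  proof safe
    fix x assume "x \<in> S"
    from that(3)[OF this] show "R \<le> norm (f x + g x)"
      using norm_fiber[of "f x" "g x"] by linarith
  qed
qed

definition far :: "'h set" where "far = {u \<in> M. R1 \<le> norm u}"

lemma farD: "u \<in> far \<Longrightarrow> u \<in> M" "u \<in> far \<Longrightarrow> R1 \<le> norm u" "u \<in> far \<Longrightarrow> R \<le> norm u" "u \<in> far \<Longrightarrow> u \<noteq> 0"
  using R by (auto simp: far_def)

text \<open>Concavity at the midpoint of two almost maximal points bounds their distance, so a maximising
sequence is Cauchy.\<close>

lemma fiber_maximum:
  assumes u: "u \<in> far"
  shows "\<exists>v\<in>N. \<forall>w\<in>N. L (u + w) \<le> L (u + v)"
proof -
  define s where "s = (SUP v\<in>N. L (u + v))"
  have "L (u + v) \<le> C * (norm u)\<^sup>2" if "v \<in> N" for v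
    using L_upper[OF farD(1)[OF u] that farD(3)[OF u]] mult_nonneg_nonneg[of "a - l" "(norm v)\<^sup>2"] l(2)
    by (auto intro: order_trans)
  then have bdd: "bdd_above ((\<lambda>v. L (u + v)) ` N)" by (intro bdd_aboveI2)
  have le: "L (u + v) \<le> s" if "v \<in> N" for v unfolding s_def using that bdd by (rule cSUP_upper)
  have "\<exists>v\<in>N. s - 1 / real (Suc n) < L (u + v)" for n
  proof -
    have "N \<noteq> {}" using subspaces(2) subspace_0 by blast
    moreover have "s - 1 / real (Suc n) < s" by simp
    ultimately show ?thesis using bdd unfolding s_def by (subst (asm) less_cSUP_iff) auto
  qed
  then obtain v where v: "\<And>n. v n \<in> N" "\<And>n. s - 1 / real (Suc n) < L (u + v n)" by metis
  have dist: "a / 8 * (norm (v i - v k))\<^sup>2 \<le> 1 / real (Suc m)" if ik: "m \<le> i" "m \<le> k" for i k m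
  proof -
    have "(1/2) *\<^sub>R v i + (1/2) *\<^sub>R v k \<in> N" using v(1) subspaces by (intro subspace_add subspace_scale)
    from le[OF this] L_concave[OF farD(1)[OF u] farD(2)[OF u] v(1)[of i] v(1)[of k], of "1/2"]
    have "(L (u + v i) + L (u + v k)) / 2 + a / 8 * (norm (v i - v k))\<^sup>2 \<le> s" by (simp add: add_divide_distrib)
    moreover have "1 / real (Suc i) \<le> 1 / real (Suc m)" "1 / real (Suc k) \<le> 1 / real (Suc m)"
      using ik by (auto intro!: divide_left_mono)
    moreover have "q \<le> d" if "(x + y) / 2 + q \<le> s" "d1 \<le> d" "d2 \<le> d" "s - d1 < x" "s - d2 < y"
      for q x y d d1 d2 :: real using that by (simp add: field_simps)
    ultimately show ?thesis using v(2)[of i] v(2)[of k] by blast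
  qed
  have "Cauchy v"
  proof (rule metric_CauchyI)
    fix e :: real assume e: "0 < e"
    then have "0 < a / 8 * e\<^sup>2" using l by simp
    then obtain m where m: "1 / real (Suc m) < a / 8 * e\<^sup>2"
      by (metis nat_approx_posE)
    have "dist (v i) (v k) < e" if "m \<le> i" "m \<le> k" for i k
    proof -
      have "a / 8 * (norm (v i - v k))\<^sup>2 < a / 8 * e\<^sup>2" using dist[OF that] m by linarith
      then have "(norm (v i - v k))\<^sup>2 < e\<^sup>2" using l by simp
      then show ?thesis unfolding dist_norm using e by (auto intro: power2_less_imp_less[of "norm (v i - v k)" e])
    qed
    then show "\<exists>m. \<forall>i\<ge>m. \<forall>k\<ge>m. dist (v i) (v k) < e" by blast
  qed
  then obtain z where z: "v \<longlonglongrightarrow> z" using Cauchy_convergent_iff convergent_def by blast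
  have zN: "z \<in> N" using closed_sequentially[OF closed_N _ z] v(1) by blast
  have "continuous_on N (\<lambda>v. L (u + v))"
    by (intro L_line_continuous continuous_intros) (use farD u in auto)
  then have "(\<lambda>n. L (u + v n)) \<longlonglongrightarrow> L (u + z)"
    using z zN v(1) by (auto intro: continuous_on_tendsto_compose)
  moreover have "(\<lambda>n. s - 1 / real (Suc n)) \<longlonglongrightarrow> s - 0"
    using LIMSEQ_inverse_real_of_nat by (intro tendsto_diff tendsto_const) (simp add: inverse_eq_divide)
  ultimately have "s - 0 \<le> L (u + z)"
    using v(2) by (intro LIMSEQ_le[of _ "s - 0" "\<lambda>n. L (u + v n)"]) (auto intro: less_imp_le)
  then have "\<forall>w\<in>N. L (u + w) \<le> L (u + z)" using le by force
  then show ?thesis using zN by blast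
qed

text \<open>The crest of the saddle: the point at which \<open>L\<close> is maximal on the fibre over \<open>u\<close>.\<close>

definition h :: "'h \<Rightarrow> 'h" where "h u = (SOME v. v \<in> N \<and> (\<forall>w\<in>N. L (u + w) \<le> L (u + v)))"

definition J :: "'h \<Rightarrow> real" where "J u = L (u + h u)"

lemma
  assumes "u \<in> far"
  shows h_N: "h u \<in> N" and J_max: "w \<in> N \<Longrightarrow> L (u + w) \<le> J u"
proof -
  have "\<exists>v. v \<in> N \<and> (\<forall>w\<in>N. L (u + w) \<le> L (u + v))" using fiber_maximum[OF assms] by blast
  from someI_ex[OF this] have "h u \<in> N \<and> (\<forall>w\<in>N. L (u + w) \<le> L (u + h u))"
    unfolding h_def .
  then show "h u \<in> N" "w \<in> N \<Longrightarrow> L (u + w) \<le> J u" unfolding J_def by auto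
qed

text \<open>Uniform concavity at the midpoint of \<open>v\<close> and the maximum point.\<close>

lemma J_gap: "a / 4 * (norm (v - h u))\<^sup>2 \<le> J u - L (u + v)" if u: "u \<in> far" and v: "v \<in> N"
proof -
  have "(1/2) *\<^sub>R h u + (1/2) *\<^sub>R v \<in> N"
    using v h_N[OF u] subspaces by (intro subspace_add subspace_scale)
  from J_max[OF u this] L_concave[OF farD(1)[OF u] farD(2)[OF u] h_N[OF u] v, of "1/2"]
  have "(J u + L (u + v)) / 2 + a / 8 * (norm (v - h u))\<^sup>2 \<le> J u"
    by (simp add: J_def norm_minus_commute add_divide_distrib)
  then show ?thesis by (simp add: field_simps)
qed

lemma J_bounds: "(a - l) * (norm u)\<^sup>2 \<le> J u" "J u \<le> C * (norm u)\<^sup>2" if u: "u \<in> far"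
proof -
  show "(a - l) * (norm u)\<^sup>2 \<le> J u"
    using L_lower[of u] J_max[OF u, of 0] farD[OF u] subspaces(2) by (simp add: subspace_0)
  have "0 \<le> (a - l) * (norm (h u))\<^sup>2" using l by simp
  then show "J u \<le> C * (norm u)\<^sup>2"
    using L_upper[OF farD(1)[OF u] h_N[OF u] farD(3)[OF u]] by (simp add: J_def)
qed

text \<open>The maximum is at least the value at \<open>v = 0\<close>, and \<open>L\<close> is already smaller than that far out on the
fibre.\<close>

lemma h_bound: "norm (h u) \<le> sqrt (C / (a - l)) * norm u" if u: "u \<in> far"
proof -
  have "0 \<le> (a - l) * (norm u)\<^sup>2" using l by simp
  then have "(a - l) * (norm (h u))\<^sup>2 \<le> C * (norm u)\<^sup>2"
    using L_upper[OF farD(1)[OF u] h_N[OF u] farD(3)[OF u]] J_bounds[OF u] by (simp add: J_def)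
  then have "(norm (h u))\<^sup>2 \<le> C / (a - l) * (norm u)\<^sup>2" using l by (simp add: field_simps)
  also have "\<dots> = (sqrt (C / (a - l)) * norm u)\<^sup>2"
    using C_pos l by (simp add: power_mult_distrib)
  finally show ?thesis by (rule power2_le_imp_le) (use C_pos l in auto)
qed

text \<open>\<open>L\<close> varies uniformly along bounded parts of neighbouring fibres.  This replaces local compactness
in the proof that the maximum over a fibre depends continuously on the fibre.\<close>

lemma L_fiber_shift:
  assumes u: "u \<in> M" "u' \<in> M" and w: "norm w \<le> 1" "w \<in> M" "R < inner u w" "R < inner u' w" and v: "v \<in> N"
    and K: "norm u + norm v \<le> K" "norm u' + norm v \<le> K"
  shows "\<bar>L (u' + v) - L (u + v)\<bar> \<le> \<bar>b u' - b u\<bar> + l * K * norm (u' - u)"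
proof -
  have iv: "inner v w = 0" using orth[OF w(2) v] by (simp add: inner_commute)
  have "\<bar>(L (u' + v) - b (u' + v)) - (L (u + v) - b (u + v))\<bar>
      \<le> l * max (norm (u + v)) (norm (u' + v)) * norm ((u' + v) - (u + v))"
    unfolding b_def by (rule L_segment[OF w(1)]) (use w iv in \<open>auto simp: inner_add_left\<close>)
  also have "\<dots> \<le> l * K * norm (u' - u)"
  proof -
    have "max (norm (u + v)) (norm (u' + v)) \<le> K"
      using K norm_triangle_ineq[of u v] norm_triangle_ineq[of u' v] by linarith
    then have "l * max (norm (u + v)) (norm (u' + v)) \<le> l * K" using l by (intro mult_left_mono) auto
    then show ?thesis by (simp add: mult_right_mono)
  qed
  finally show ?thesis using b_split u v by auto
qed

lemma continuous_on_J: "continuous_on far J"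
  unfolding continuous_on_def
proof
  fix u0 assume u0: "u0 \<in> far"
  \<comment> \<open>For \<open>u\<close> near \<open>u0\<close> the points \<open>u0 + v\<close> and \<open>u + v\<close> lie in a common half-space with normal \<open>w\<close>
    outside the ball of radius \<open>R\<close>.\<close>
  define w where "w = sgn u0"
  have w: "norm w \<le> 1" "w \<in> M" "inner u0 w = norm u0"
    unfolding w_def using sgn_direction[OF farD(1)[OF u0] farD(4)[OF u0]] by auto
  define K where "K = (norm u0 + 1) * (1 + sqrt (C / (a - l)))"
  have hK: "norm u + norm (h u') \<le> K"
    if "norm u \<le> norm u0 + 1" "u' \<in> far" "norm u' \<le> norm u0 + 1" for u u' :: 'h
  proof -
    have "sqrt (C / (a - l)) * norm u' \<le> sqrt (C / (a - l)) * (norm u0 + 1)"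
      using that C_pos l by (intro mult_left_mono) auto
    then show ?thesis using h_bound[OF that(2)] that(1) unfolding K_def by (simp add: algebra_simps)
  qed
  have close: "\<bar>J u - J u0\<bar> \<le> \<bar>b u - b u0\<bar> + l * K * norm (u - u0)"
    if u: "u \<in> far" and iw: "R < inner u w" and n: "norm u < norm u0 + 1" for u
  proof -
    have w0: "R < inner u0 w" using w(3) farD(2)[OF u0] R by simp
    have 1: "\<bar>L (u + h u) - L (u0 + h u)\<bar> \<le> \<bar>b u - b u0\<bar> + l * K * norm (u - u0)"
      by (rule L_fiber_shift[OF farD(1)[OF u0] farD(1)[OF u] w(1,2) w0 iw h_N[OF u]])
        (use hK u n in auto)
    have 2: "\<bar>L (u + h u0) - L (u0 + h u0)\<bar> \<le> \<bar>b u - b u0\<bar> + l * K * norm (u - u0)"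
      by (rule L_fiber_shift[OF farD(1)[OF u0] farD(1)[OF u] w(1,2) w0 iw h_N[OF u0]])
        (use hK u0 n in auto)
    show ?thesis using 1 2 J_max[OF u h_N[OF u0]] J_max[OF u0 h_N[OF u]] unfolding J_def by linarith
  qed
  let ?F = "at u0 within far"
  have lim: "((\<lambda>u. \<bar>b u - b u0\<bar> + l * K * norm (u - u0)) \<longlongrightarrow> \<bar>b u0 - b u0\<bar> + l * K * norm (u0 - u0)) ?F"
    using u0 continuous_on_b[OF continuous_on_id, of far] unfolding continuous_on_def
    by (intro tendsto_intros) auto
  have "((\<lambda>u. inner u w) \<longlongrightarrow> inner u0 w) ?F" by (intro tendsto_intros)
  then have ev1: "\<forall>\<^sub>F u in ?F. R < inner u w"
    by (rule order_tendstoD) (use w(3) farD(2)[OF u0] R in simp)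
  have "((\<lambda>u. norm u) \<longlongrightarrow> norm u0) ?F" by (intro tendsto_intros)
  then have ev2: "\<forall>\<^sub>F u in ?F. norm u < norm u0 + 1" by (rule order_tendstoD) simp
  have ev3: "\<forall>\<^sub>F u in ?F. u \<in> far" by (simp add: eventually_at_filter)
  have "((\<lambda>u. J u - J u0) \<longlongrightarrow> 0) ?F"
  proof (rule Lim_null_comparison)
    show "\<forall>\<^sub>F u in ?F. norm (J u - J u0) \<le> \<bar>b u - b u0\<bar> + l * K * norm (u - u0)"
      using ev1 ev2 ev3 by eventually_elim (use close in auto)
    show "((\<lambda>u. \<bar>b u - b u0\<bar> + l * K * norm (u - u0)) \<longlongrightarrow> 0) ?F" using lim by simp
  qed
  then show "(J \<longlongrightarrow> J u0) ?F" by (simp add: LIM_zero_iff)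
qed

lemma continuous_on_h: "continuous_on far h"
  unfolding continuous_on_def
proof
  fix u0 assume u0: "u0 \<in> far"
  let ?F = "at u0 within far"
  let ?g = "\<lambda>u. sqrt (4 / a * (J u - L (u + h u0)))"
  have "continuous_on far ?g"
    using h_N[OF u0] farD by (intro continuous_intros continuous_on_J L_line_continuous) auto
  then have "(?g \<longlongrightarrow> ?g u0) ?F" using u0 unfolding continuous_on_def by blast
  then have lim: "(?g \<longlongrightarrow> 0) ?F" by (simp add: J_def)
  have "norm (h u - h u0) \<le> ?g u" if u: "u \<in> far" for u
  proof (rule real_le_rsqrt)
    show "(norm (h u - h u0))\<^sup>2 \<le> 4 / a * (J u - L (u + h u0))"
      using J_gap[OF u h_N[OF u0]] l by (simp add: field_simps norm_minus_commute)
  qed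
  then have "((\<lambda>u. h u - h u0) \<longlongrightarrow> 0) ?F"
    by (intro Lim_null_comparison[OF _ lim]) (auto simp: eventually_at_filter)
  then show "(h \<longlongrightarrow> h u0) ?F" by (simp add: LIM_zero_iff)
qed

text \<open>The direction of the segment from \<open>u + v\<close> to \<open>t u + v/t\<close> increases the \<open>M\<close>-part and decreases the
\<open>N\<close>-part, so both terms of \<open>b\<close> grow.  With \<open>S = (norm u)\<^sup>2 + (norm v / t)\<^sup>2\<close>, the gain of \<open>b\<close> is at least
\<open>a (t\<^sup>2 - 1) S\<close>, while the segment has length \<open>(t - 1) sqrt S\<close> and stays in the ball of radius
\<open>t sqrt S\<close>, so that the perturbation costs at most \<open>l t (t - 1) S\<close>.\<close>

lemma L_hyperbolic_growth:
  assumes u: "u \<in> M" "R < norm u" and v: "v \<in> N" and t: "1 < t"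
  shows "L (u + v) < L (t *\<^sub>R u + (1/t) *\<^sub>R v)"
proof -
  define x where "x = u + v"
  define y where "y = t *\<^sub>R u + (1/t) *\<^sub>R v"
  define S where "S = (norm u)\<^sup>2 + (1/t)\<^sup>2 * (norm v)\<^sup>2"
  have tu: "t *\<^sub>R u \<in> M" "(t - 1) *\<^sub>R u \<in> M" "(1/t) *\<^sub>R v \<in> N" "(1/t - 1) *\<^sub>R v \<in> N"
    using u v subspaces by (auto intro: subspace_scale)
  have un: "0 < (norm u)\<^sup>2" using u(2) R by auto
  have S0: "0 < S" unfolding S_def using un by (simp add: add_pos_nonneg)
  have t2: "1 \<le> t\<^sup>2" using t by simp
  have nx: "norm x \<le> t * sqrt S"
  proof (rule power2_le_imp_le)
    have "(norm x)\<^sup>2 = (norm u)\<^sup>2 + (norm v)\<^sup>2" unfolding x_def using pythagoras u v by blast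
    also have "\<dots> \<le> t\<^sup>2 * (norm u)\<^sup>2 + (norm v)\<^sup>2"
      using mult_right_mono[OF t2, of "(norm u)\<^sup>2"] by simp
    also have "\<dots> = (t * sqrt S)\<^sup>2"
      using S0 t by (simp add: power_mult_distrib S_def power_divide field_simps)
    finally show "(norm x)\<^sup>2 \<le> (t * sqrt S)\<^sup>2" .
    show "0 \<le> t * sqrt S" using t S0 by simp
  qed
  have ny: "norm y \<le> t * sqrt S"
  proof (rule power2_le_imp_le)
    have "(norm y)\<^sup>2 = t\<^sup>2 * (norm u)\<^sup>2 + (1/t)\<^sup>2 * (norm v)\<^sup>2"
      unfolding y_def using pythagoras[OF tu(1,3)] by (simp add: power_mult_distrib power_divide)
    also have "\<dots> \<le> t\<^sup>2 * (norm u)\<^sup>2 + t\<^sup>2 * ((1/t)\<^sup>2 * (norm v)\<^sup>2)"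
      using mult_right_mono[OF t2, of "(1/t)\<^sup>2 * (norm v)\<^sup>2"] by simp
    also have "\<dots> = (t * sqrt S)\<^sup>2"
      using S0 by (simp add: power_mult_distrib S_def distrib_left)
    finally show "(norm y)\<^sup>2 \<le> (t * sqrt S)\<^sup>2" .
    show "0 \<le> t * sqrt S" using t S0 by simp
  qed
  have nd: "norm (y - x) = (t - 1) * sqrt S"
  proof -
    have "y - x = (t - 1) *\<^sub>R u + (1/t - 1) *\<^sub>R v" unfolding x_def y_def by (simp add: algebra_simps)
    then have "(norm (y - x))\<^sup>2 = (t - 1)\<^sup>2 * (norm u)\<^sup>2 + (1/t - 1)\<^sup>2 * (norm v)\<^sup>2"
      using pythagoras[OF tu(2,4)] by (simp add: power_mult_distrib)
    also have "(1/t - 1)\<^sup>2 = (t - 1)\<^sup>2 * (1/t)\<^sup>2"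
      using t by (simp add: power2_eq_square field_simps)
    finally have "(norm (y - x))\<^sup>2 = ((t - 1) * sqrt S)\<^sup>2"
      using S0 by (simp add: power_mult_distrib S_def distrib_left mult.assoc)
    then show ?thesis using t S0 by (simp add: power2_eq_iff_nonneg)
  qed
  define w where "w = sgn u"
  have w: "norm w \<le> 1" "w \<in> M" "inner u w = norm u"
    unfolding w_def using sgn_direction[OF u(1)] u(2) R by force+
  have iv: "inner v w = 0" using orth[OF w(2) v] by (simp add: inner_commute)
  have "1 * norm u \<le> t * norm u" using t by (intro mult_right_mono) auto
  then have xw: "R < inner x w" "R < inner y w"
    unfolding x_def y_def using w iv u(2) by (auto simp: inner_add_left)
  have "\<bar>(L y - b y) - (L x - b x)\<bar> \<le> l * max (norm x) (norm y) * norm (y - x)"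
    unfolding b_def by (rule L_segment[OF w(1) xw])
  also have "\<dots> \<le> l * (t * sqrt S) * ((t - 1) * sqrt S)"
    unfolding nd using nx ny l t S0 by (intro mult_right_mono mult_left_mono) auto
  also have "\<dots> = l * t * (t - 1) * S" using S0 by (simp add: algebra_simps)
  finally have 1: "L y - L x \<ge> b y - b x - l * t * (t - 1) * S" by linarith
  have "b y - b x = (t\<^sup>2 - 1) * b u + ((1/t)\<^sup>2 - 1) * b v"
    unfolding x_def y_def using b_split u v tu by (simp add: b_scale algebra_simps)
  also have "(1/t)\<^sup>2 - 1 = - ((t\<^sup>2 - 1) * (1/t)\<^sup>2)"
    using t by (simp add: power2_eq_square field_simps)
  finally have "b y - b x = (t\<^sup>2 - 1) * (b u - (1/t)\<^sup>2 * b v)" by (simp add: algebra_simps)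
  moreover have "a * S \<le> b u - (1/t)\<^sup>2 * b v"
  proof -
    have "(1/t)\<^sup>2 * b v \<le> (1/t)\<^sup>2 * (- a * (norm v)\<^sup>2)" using b_N[OF v] by (intro mult_left_mono) auto
    then show ?thesis using b_M[OF u(1)] unfolding S_def by (simp add: algebra_simps)
  qed
  ultimately have 2: "b y - b x \<ge> (t\<^sup>2 - 1) * (a * S)" using t2 by (simp add: mult_left_mono)
  have "l * t * (t - 1) * S < (t\<^sup>2 - 1) * (a * S)"
  proof -
    have "l * t \<le> a * t" using l t by (intro mult_right_mono) auto
    then have "l * t < a * (t + 1)" using l by (simp add: distrib_left)
    then have "(l * t) * ((t - 1) * S) < (a * (t + 1)) * ((t - 1) * S)"
      using t S0 by (intro mult_strict_right_mono) auto
    then show ?thesis by (simp add: power2_eq_square algebra_simps)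
  qed
  then show ?thesis using 1 2 unfolding x_def y_def by linarith
qed

lemma J_strict_mono_ray: "J (\<sigma> *\<^sub>R e) < J (\<tau> *\<^sub>R e)"
  if e: "e \<in> M" "norm e = 1" and s: "R1 \<le> \<sigma>" "\<sigma> < \<tau>"
proof -
  have f: "\<sigma> *\<^sub>R e \<in> far" "\<tau> *\<^sub>R e \<in> far"
    using e s R subspaces by (auto simp: far_def subspace_scale)
  have "\<sigma> > 0" using s R by linarith
  then have t: "1 < \<tau> / \<sigma>" using s by simp
  have "J (\<sigma> *\<^sub>R e) < L ((\<tau> / \<sigma>) *\<^sub>R (\<sigma> *\<^sub>R e) + (1 / (\<tau> / \<sigma>)) *\<^sub>R h (\<sigma> *\<^sub>R e))"
    unfolding J_def using f h_N s R e \<open>\<sigma> > 0\<close> by (intro L_hyperbolic_growth t) (auto simp: far_def)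
  also have "\<dots> = L (\<tau> *\<^sub>R e + (1 / (\<tau> / \<sigma>)) *\<^sub>R h (\<sigma> *\<^sub>R e))" using \<open>\<sigma> > 0\<close> by simp
  also have "\<dots> \<le> J (\<tau> *\<^sub>R e)"
    by (intro J_max f subspace_scale subspaces h_N)
  finally show ?thesis .
qed

section \<open>The chart of the saddle\<close>

text \<open>Any radius with \<open>C * R1\<^sup>2 \<le> r0\<^sup>2\<close> would do: then \<open>J\<close> is below \<open>(norm u)\<^sup>2\<close> on the sphere of radius
\<open>R1\<close> whenever \<open>norm u > r0\<close>, so that the root sought on the ray through \<open>u\<close> lies beyond that sphere.\<close>

definition r0 :: real where "r0 = (C + 1) * R1"

lemma r0_pos: "0 < r0" unfolding r0_def using C_pos R1_pos by simp

lemma C_R1_le: "C * R1\<^sup>2 \<le> r0\<^sup>2"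
proof -
  have "C \<le> (C + 1)\<^sup>2" using C_pos by (simp add: power2_eq_square algebra_simps)
  then show ?thesis unfolding r0_def power_mult_distrib by (intro mult_right_mono) auto
qed

lemma ray_far: "u \<in> M \<Longrightarrow> u \<noteq> 0 \<Longrightarrow> R1 \<le> \<sigma> \<Longrightarrow> \<sigma> *\<^sub>R sgn u \<in> far"
  using sgn_direction[of u] R1_pos subspaces by (simp add: far_def subspace_scale)

lemma radius_exists:
  assumes u: "u \<in> M" "r0 < norm u"
  shows "\<exists>\<sigma>>R1. J (\<sigma> *\<^sub>R sgn u) = (norm u)\<^sup>2"
proof -
  have u0: "u \<noteq> 0" using u r0_pos by auto
  note d = sgn_direction[OF u(1) u0]
  define f where "f \<sigma> = J (\<sigma> *\<^sub>R sgn u)" for \<sigma>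
  \<comment> \<open>At this radius the lower bound on \<open>J\<close> is already at least \<open>(norm u)\<^sup>2\<close>.\<close>
  define s where "s = norm u / sqrt (a - l) + R1"
  have s: "R1 \<le> s" "norm u / sqrt (a - l) \<le> s" unfolding s_def using l R1_pos by auto
  have far: "\<sigma> *\<^sub>R sgn u \<in> far" if "R1 \<le> \<sigma>" for \<sigma> using ray_far u u0 that by blast
  have "f R1 \<le> C * R1\<^sup>2"
    unfolding f_def using J_bounds(2)[OF far[of R1]] d R1_pos by simp
  also have "\<dots> \<le> r0\<^sup>2" by (rule C_R1_le)
  also have "\<dots> < (norm u)\<^sup>2" using u r0_pos by (intro power_strict_mono) auto
  finally have lo: "f R1 < (norm u)\<^sup>2" .
  have "(norm u)\<^sup>2 = (a - l) * (norm u / sqrt (a - l))\<^sup>2" using l by (simp add: power_divide)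
  also have "\<dots> \<le> (a - l) * s\<^sup>2" using s l by (intro mult_left_mono power_mono) auto
  also have "\<dots> \<le> f s" unfolding f_def using J_bounds(1)[OF far[OF s(1)]] d s(1) R1_pos by simp
  finally have hi: "(norm u)\<^sup>2 \<le> f s" .
  have "continuous_on {R1..s} f" unfolding f_def
    by (intro continuous_on_compose2[OF continuous_on_J] continuous_intros) (use far in auto)
  from IVT'[OF less_imp_le[OF lo] hi s(1) this]
  obtain \<sigma> where "R1 \<le> \<sigma>" "f \<sigma> = (norm u)\<^sup>2" by blast
  moreover from this lo have "\<sigma> \<noteq> R1" by auto
  ultimately show ?thesis unfolding f_def by (intro exI[of _ \<sigma>]) auto
qed

definition radius :: "'h \<Rightarrow> real" where
  "radius u = (SOME \<sigma>. R1 < \<sigma> \<and> J (\<sigma> *\<^sub>R sgn u) = (norm u)\<^sup>2)"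

text \<open>The point on the ray through \<open>u\<close> over which the crest has height \<open>(norm u)\<^sup>2\<close>.\<close>

definition base :: "'h \<Rightarrow> 'h" where "base u = radius u *\<^sub>R sgn u"

lemma
  assumes "u \<in> M" "r0 < norm u"
  shows radius_gt: "R1 < radius u" and J_base: "J (base u) = (norm u)\<^sup>2"
  using someI_ex[OF radius_exists[OF assms, unfolded Bex_def]]
  unfolding radius_def[symmetric] base_def by auto

lemma radius_eqI:
  assumes u: "u \<in> M" "r0 < norm u" and s: "R1 < \<sigma>" "J (\<sigma> *\<^sub>R sgn u) = (norm u)\<^sup>2"
  shows "radius u = \<sigma>"
proof -
  have u0: "u \<noteq> 0" using u r0_pos by auto
  note d = sgn_direction[OF u(1) u0]
  show ?thesis
    using J_strict_mono_ray[OF d(1,2), of \<sigma> "radius u"] J_strict_mono_ray[OF d(1,2), of "radius u" \<sigma>]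
      radius_gt[OF u] J_base[OF u] s unfolding base_def by (cases "radius u" \<sigma> rule: linorder_cases) auto
qed

lemma base_far:
  assumes "u \<in> M" "r0 < norm u"
  shows "base u \<in> far" "norm (base u) = radius u" "sgn (base u) = sgn u"
proof -
  have u0: "u \<noteq> 0" using assms r0_pos by auto
  have g: "R1 < radius u" using assms by (rule radius_gt)
  show "base u \<in> far" unfolding base_def using ray_far[OF assms(1) u0] g by simp
  show "norm (base u) = radius u" "sgn (base u) = sgn u"
    unfolding base_def using g R1_pos u0 by (auto simp: norm_sgn sgn_scaleR sgn_sgn_vector)
qed

lemma continuous_on_base: "continuous_on {u \<in> M. r0 < norm u} base"
proof -
  let ?D = "{u \<in> M. r0 < norm u}"
  have nz: "u \<noteq> 0" if "u \<in> ?D" for u using that r0_pos by auto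
  have sg: "continuous_on ?D sgn"
    using nz by (intro continuous_on_sgn continuous_on_id) auto
  have "continuous_on ?D radius"
  proof (rule continuous_on_monotone_root[where k = R1 and F = "\<lambda>u \<sigma>. J (\<sigma> *\<^sub>R sgn u)"
        and c = "\<lambda>u. (norm u)\<^sup>2"])
    fix \<sigma> assume "R1 < \<sigma>"
    then show "continuous_on ?D (\<lambda>u. J (\<sigma> *\<^sub>R sgn u))"
      using ray_far nz by (intro continuous_on_compose2[OF continuous_on_J] continuous_intros sg) auto
  next
    fix u \<sigma> \<tau> assume "u \<in> ?D" "R1 < \<sigma>" "\<sigma> < \<tau>"
    then show "J (\<sigma> *\<^sub>R sgn u) < J (\<tau> *\<^sub>R sgn u)"
      using nz sgn_direction by (intro J_strict_mono_ray) auto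
  qed (use radius_gt J_base in \<open>auto simp: base_def intro!: continuous_intros\<close>)
  then show ?thesis unfolding base_def[abs_def] by (intro continuous_intros sg)
qed

text \<open>How far \<open>L\<close> lies below the crest, at displacement \<open>w\<close> from it on the fibre over \<open>u\<close>.\<close>

definition depth :: "'h \<Rightarrow> 'h \<Rightarrow> real" where "depth u w = J u - L (u + (h u + w))"

lemma depth_zero: "depth u 0 = 0" by (simp add: depth_def J_def)

lemma depth_ge: "u \<in> far \<Longrightarrow> w \<in> N \<Longrightarrow> a / 4 * (norm w)\<^sup>2 \<le> depth u w"
  using J_gap[of u "h u + w"] h_N[of u] subspaces unfolding depth_def by (simp add: subspace_add)

text \<open>On the ray from the crest a nearer point is a convex combination of the crest and a farther
point, and the crest is strictly higher than the latter.\<close>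

lemma depth_strict_mono:
  assumes u: "u \<in> far" and v: "v \<in> N" "v \<noteq> 0" and s: "0 \<le> \<sigma>" "\<sigma> < \<tau>"
  shows "depth u (\<sigma> *\<^sub>R v) < depth u (\<tau> *\<^sub>R v)"
proof -
  define t where "t = \<sigma> / \<tau>"
  have t: "0 \<le> t" "t < 1" "t * \<tau> = \<sigma>" unfolding t_def using s by auto
  let ?w = "h u + \<tau> *\<^sub>R v"
  have wN: "?w \<in> N" using h_N[OF u] v subspaces by (simp add: subspace_add subspace_scale)
  have "(1 - t) * L (u + h u) + t * L (u + ?w) + a/2 * (t * (1 - t)) * (norm (h u - ?w))\<^sup>2
      \<le> L (u + ((1 - t) *\<^sub>R h u + t *\<^sub>R ?w))"
    using t by (intro L_concave farD(1,2)[OF u] h_N[OF u] wN) auto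
  moreover have "(1 - t) *\<^sub>R h u + t *\<^sub>R ?w = h u + \<sigma> *\<^sub>R v"
    using t(3) by (simp add: algebra_simps)
  moreover have "0 \<le> a/2 * (t * (1 - t)) * (norm (h u - ?w))\<^sup>2" using l t by simp
  ultimately have 1: "(1 - t) * J u + t * L (u + ?w) \<le> L (u + (h u + \<sigma> *\<^sub>R v))"
    unfolding J_def by simp
  have "0 < a / 4 * (norm (\<tau> *\<^sub>R v))\<^sup>2" using l v s by simp
  also have "\<dots> \<le> J u - L (u + ?w)"
    using depth_ge[OF u, of "\<tau> *\<^sub>R v"] v subspaces by (simp add: depth_def subspace_scale)
  finally have "0 < (1 - t) * (J u - L (u + ?w))" using t by (intro mult_pos_pos) auto
  then show ?thesis using 1 unfolding depth_def by (simp add: algebra_simps)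
qed

lemma continuous_on_depth:
  assumes "continuous_on S f" "continuous_on S g" "\<And>x. x \<in> S \<Longrightarrow> f x \<in> far \<and> g x \<in> N"
  shows "continuous_on S (\<lambda>x. depth (f x) (g x))"
proof -
  have hf: "continuous_on S (\<lambda>x. h (f x))" "continuous_on S (\<lambda>x. J (f x))"
    using assms(3) by (auto intro!: continuous_on_compose2[OF continuous_on_h]
        continuous_on_compose2[OF continuous_on_J] assms(1))
  have "f x \<in> M \<and> R \<le> norm (f x) \<and> h (f x) + g x \<in> N" if "x \<in> S" for x
    using assms(3)[OF that] h_N farD subspaces by (auto intro: subspace_add)
  then show ?thesis unfolding depth_def
    by (intro continuous_intros hf L_line_continuous assms(1,2))
qed

lemma stretch_exists:
  assumes u: "u \<in> far" and v: "v \<in> N" "v \<noteq> 0"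
  shows "\<exists>\<sigma>>0. \<sigma> \<le> 2 / sqrt a \<and> depth u (\<sigma> *\<^sub>R v) = (norm v)\<^sup>2"
proof -
  have sv: "\<sigma> *\<^sub>R v \<in> N" for \<sigma> using v subspaces by (simp add: subspace_scale)
  have p: "0 < 2 / sqrt a" using l by simp
  have "continuous_on {0..2 / sqrt a} (\<lambda>\<sigma>. depth u (\<sigma> *\<^sub>R v))"
    using u sv by (intro continuous_on_depth continuous_intros) auto
  moreover have "(norm v)\<^sup>2 \<le> depth u ((2 / sqrt a) *\<^sub>R v)"
    using depth_ge[OF u sv[of "2 / sqrt a"]] l by (simp add: power_mult_distrib power_divide)
  moreover have "depth u (0 *\<^sub>R v) < (norm v)\<^sup>2" using v by (simp add: depth_zero)
  ultimately obtain \<sigma> where "0 \<le> \<sigma>" "\<sigma> \<le> 2 / sqrt a" "depth u (\<sigma> *\<^sub>R v) = (norm v)\<^sup>2"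
    using IVT'[of "\<lambda>\<sigma>. depth u (\<sigma> *\<^sub>R v)" 0 "(norm v)\<^sup>2" "2 / sqrt a"] p by auto
  moreover from this have "\<sigma> \<noteq> 0" using v by (auto simp: depth_zero)
  ultimately show ?thesis by (intro exI[of _ \<sigma>]) auto
qed

text \<open>The upper bound makes the displacement \<open>stretch u v *\<^sub>R v\<close> tend to \<open>0\<close> with \<open>v\<close>, which is what
continuity at \<open>v = 0\<close> needs.\<close>

definition stretch :: "'h \<Rightarrow> 'h \<Rightarrow> real" where
  "stretch u v = (SOME \<sigma>. 0 < \<sigma> \<and> \<sigma> \<le> 2 / sqrt a \<and> depth u (\<sigma> *\<^sub>R v) = (norm v)\<^sup>2)"

lemma
  assumes "u \<in> far" "v \<in> N" "v \<noteq> 0"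
  shows stretch_pos: "0 < stretch u v" and stretch_le: "stretch u v \<le> 2 / sqrt a"
    and depth_stretch_nz: "depth u (stretch u v *\<^sub>R v) = (norm v)\<^sup>2"
  using someI_ex[OF stretch_exists[OF assms]] unfolding stretch_def[symmetric] by auto

lemma depth_stretch: "u \<in> far \<Longrightarrow> v \<in> N \<Longrightarrow> depth u (stretch u v *\<^sub>R v) = (norm v)\<^sup>2"
  by (cases "v = 0") (auto simp: depth_zero depth_stretch_nz)

lemma stretch_eqI:
  assumes u: "u \<in> far" "v \<in> N" "v \<noteq> 0" and s: "0 < \<sigma>" "depth u (\<sigma> *\<^sub>R v) = (norm v)\<^sup>2"
  shows "stretch u v = \<sigma>"
  using depth_strict_mono[OF u, of \<sigma> "stretch u v"] depth_strict_mono[OF u, of "stretch u v" \<sigma>]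
    stretch_pos[OF u] depth_stretch_nz[OF u] s
  by (cases "stretch u v" \<sigma> rule: linorder_cases) auto

lemma continuous_on_stretch: "continuous_on (far \<times> N) (\<lambda>(u, v). stretch u v *\<^sub>R v)"
proof (rule continuous_on_scaleR_vanishing[where w = snd and g = "\<lambda>x. 2 / sqrt a * norm (snd x)"])
  let ?D = "{x \<in> far \<times> N. snd x \<noteq> 0}"
  have sN: "\<sigma> *\<^sub>R v \<in> N" if "v \<in> N" for \<sigma> v using that subspaces by (simp add: subspace_scale)
  have "continuous_on ?D (\<lambda>x. stretch (fst x) (snd x))"
  proof (rule continuous_on_monotone_root[where k = 0 and F = "\<lambda>x \<sigma>. depth (fst x) (\<sigma> *\<^sub>R snd x)"
        and c = "\<lambda>x. (norm (snd x))\<^sup>2"])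
    show "continuous_on ?D (\<lambda>x. depth (fst x) (\<sigma> *\<^sub>R snd x))" for \<sigma> :: real
      using sN by (intro continuous_on_depth continuous_intros) auto
  next
    fix x and \<sigma> \<tau> :: real assume "x \<in> ?D" "0 < \<sigma>" "\<sigma> < \<tau>"
    then show "depth (fst x) (\<sigma> *\<^sub>R snd x) < depth (fst x) (\<tau> *\<^sub>R snd x)"
      by (intro depth_strict_mono) auto
  qed (auto simp: stretch_pos depth_stretch intro!: continuous_intros)
  then show "continuous_on ?D (\<lambda>(u, v). stretch u v *\<^sub>R v)"
    unfolding case_prod_beta by (intro continuous_intros)
  show "norm (case x of (u, v) \<Rightarrow> stretch u v *\<^sub>R v) \<le> 2 / sqrt a * norm (snd x)"
    if "x \<in> far \<times> N" for x
  proof (cases "snd x = 0")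
    case False
    then have "\<bar>stretch (fst x) (snd x)\<bar> \<le> 2 / sqrt a"
      using that stretch_pos[of "fst x" "snd x"] stretch_le[of "fst x" "snd x"] by auto
    then show ?thesis unfolding case_prod_beta by (simp only: norm_scaleR) (intro mult_right_mono, auto)
  qed (auto simp: case_prod_beta)
qed (use l in \<open>auto intro!: continuous_intros\<close>)

definition chart :: "'h \<Rightarrow> 'h" where
  "chart x = base (p x) + (h (base (p x)) + stretch (base (p x)) (x - p x) *\<^sub>R (x - p x))"

text \<open>Since \<open>sgn 0 = 0\<close>, the formula is also correct on the crest, where the second summand
vanishes.\<close>

definition inv_chart :: "'h \<Rightarrow> 'h" where
  "inv_chart y = sqrt (J (p y)) *\<^sub>R sgn (p y) + sqrt (J (p y) - L y) *\<^sub>R sgn (y - p y - h (p y))"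

definition chart_dom :: "'h set" where "chart_dom = {x. r0 < norm (p x)}"

definition chart_img :: "'h set" where "chart_img = {y. R1 < norm (p y) \<and> r0\<^sup>2 < J (p y)}"

lemma chart_split:
  assumes "x \<in> chart_dom"
  shows "p x \<in> M" "r0 < norm (p x)" "x - p x \<in> N" "base (p x) \<in> far"
    "stretch (base (p x)) (x - p x) *\<^sub>R (x - p x) \<in> N" "p (chart x) = base (p x)"
    "L (chart x) = (norm (p x))\<^sup>2 - (norm (x - p x))\<^sup>2"
proof -
  show 1: "p x \<in> M" "r0 < norm (p x)" "x - p x \<in> N" using assms p by (auto simp: chart_dom_def)
  show 2: "base (p x) \<in> far" using base_far 1 by blast
  show 3: "stretch (base (p x)) (x - p x) *\<^sub>R (x - p x) \<in> N" using 1 subspaces by (simp add: subspace_scale)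
  have "h (base (p x)) + stretch (base (p x)) (x - p x) *\<^sub>R (x - p x) \<in> N"
    using 3 h_N[OF 2] subspaces by (simp add: subspace_add)
  then show "p (chart x) = base (p x)"
    unfolding chart_def using farD(1)[OF 2] by (rule p_split[rotated])
  show "L (chart x) = (norm (p x))\<^sup>2 - (norm (x - p x))\<^sup>2"
    using depth_stretch[OF 2 1(3)] J_base[OF 1(1,2)] unfolding depth_def chart_def by simp
qed

lemma chart_in_img: "x \<in> chart_dom \<Longrightarrow> chart x \<in> chart_img"
  using chart_split[of x] base_far(2)[of "p x"] radius_gt[of "p x"] J_base[of "p x"] r0_pos
  by (auto simp: chart_img_def intro!: power_strict_mono)

lemma inv_chart_chart:
  assumes x: "x \<in> chart_dom"
  shows "inv_chart (chart x) = x"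
proof -
  note c = chart_split[OF x]
  let ?u = "base (p x)" and ?v = "x - p x"
  have "chart x - ?u - h ?u = stretch ?u ?v *\<^sub>R ?v" unfolding chart_def by simp
  moreover have "norm ?v *\<^sub>R sgn (stretch ?u ?v *\<^sub>R ?v) = ?v"
  proof (cases "?v = 0")
    case False
    then show ?thesis using stretch_pos[OF c(4) c(3) False] by (simp add: sgn_scaleR norm_scaleR_sgn)
  qed simp
  moreover have "norm (p x) *\<^sub>R sgn (p x) = p x" by (rule norm_scaleR_sgn)
  ultimately show ?thesis
    unfolding inv_chart_def c(6) c(7) J_base[OF c(1,2)] base_far(3)[OF c(1,2)] by simp
qed

lemma chart_img_far: "y \<in> chart_img \<Longrightarrow> p y \<in> far"
  using p by (auto simp: chart_img_def far_def)

lemma inv_chart_split: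
  assumes y: "y \<in> chart_img"
  shows "p (inv_chart y) = sqrt (J (p y)) *\<^sub>R sgn (p y)"
    "inv_chart y - p (inv_chart y) = sqrt (J (p y) - L y) *\<^sub>R sgn (y - p y - h (p y))"
    "y - p y - h (p y) \<in> N" "norm (p (inv_chart y)) = sqrt (J (p y))"
proof -
  have f: "p y \<in> far" using y by (rule chart_img_far)
  show wN: "y - p y - h (p y) \<in> N" using p(3) h_N[OF f] subspaces by (simp add: subspace_diff)
  have "sqrt (J (p y) - L y) *\<^sub>R sgn (y - p y - h (p y)) \<in> N"
    unfolding sgn_div_norm using wN subspaces by (intro subspace_scale)
  moreover have "sqrt (J (p y)) *\<^sub>R sgn (p y) \<in> M"
    unfolding sgn_div_norm using p(2) subspaces by (intro subspace_scale)
  ultimately show e: "p (inv_chart y) = sqrt (J (p y)) *\<^sub>R sgn (p y)"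
    unfolding inv_chart_def by (intro p_split)
  then show "inv_chart y - p (inv_chart y) = sqrt (J (p y) - L y) *\<^sub>R sgn (y - p y - h (p y))"
    unfolding inv_chart_def by simp
  have "0 \<le> J (p y)" using y by (simp add: chart_img_def) (meson less_imp_le order_trans zero_le_power2)
  then show "norm (p (inv_chart y)) = sqrt (J (p y))"
    unfolding e using farD(4)[OF f] by (simp add: norm_sgn)
qed

lemma inv_chart_in_dom:
  assumes y: "y \<in> chart_img"
  shows "inv_chart y \<in> chart_dom"
proof -
  have "r0 = sqrt (r0\<^sup>2)" using r0_pos by simp
  also have "\<dots> < sqrt (J (p y))" using y by (intro real_sqrt_less_mono) (simp add: chart_img_def)
  finally show ?thesis unfolding chart_dom_def by (simp add: inv_chart_split(4)[OF y])
qed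

lemma chart_inv_chart:
  assumes y: "y \<in> chart_img"
  shows "chart (inv_chart y) = y"
proof -
  let ?u = "p y" and ?x = "inv_chart y"
  define w where "w = y - ?u - h ?u"
  note s = inv_chart_split[OF y] and x = inv_chart_in_dom[OF y]
  have f: "?u \<in> far" using y by (rule chart_img_far)
  have wN: "w \<in> N" unfolding w_def by (rule s)
  have Jpos: "0 < J ?u"
    using y by (simp add: chart_img_def) (meson le_less_trans zero_le_power2)
  have sg: "sgn (p ?x) = sgn ?u" unfolding s(1) using Jpos by (simp add: sgn_scaleR sgn_sgn_vector)
  have nu: "norm ?u *\<^sub>R sgn ?u = ?u" by (rule norm_scaleR_sgn)
  have "radius (p ?x) = norm ?u"
    using x y Jpos by (intro radius_eqI) (auto simp: chart_dom_def sg nu s(4) chart_img_def p(2))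
  then have b: "base (p ?x) = ?u" unfolding base_def sg using nu by simp
  have dw: "depth ?u w = J ?u - L y" unfolding depth_def w_def by simp
  have "stretch ?u (?x - p ?x) *\<^sub>R (?x - p ?x) = w"
  proof (cases "w = 0")
    case True
    then show ?thesis unfolding s(2) w_def[symmetric] by simp
  next
    case False
    define q where "q = sqrt (J ?u - L y)"
    have "0 < a / 4 * (norm w)\<^sup>2" using False l by simp
    also have "\<dots> \<le> J ?u - L y" using depth_ge[OF f wN] dw by simp
    finally have q: "0 < q" "q\<^sup>2 = J ?u - L y" unfolding q_def by auto
    have v: "?x - p ?x = q *\<^sub>R sgn w" unfolding s(2) q_def w_def ..
    have e: "(norm w / q) *\<^sub>R (q *\<^sub>R sgn w) = w" using q False by (simp add: norm_scaleR_sgn)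
    have "stretch ?u (q *\<^sub>R sgn w) = norm w / q"
    proof (rule stretch_eqI[OF f])
      show "q *\<^sub>R sgn w \<in> N" using chart_split(3)[OF x] v by simp
      show "q *\<^sub>R sgn w \<noteq> 0" using q False by (simp add: sgn_zero_iff)
      show "0 < norm w / q" using q False by simp
      show "depth ?u ((norm w / q) *\<^sub>R (q *\<^sub>R sgn w)) = (norm (q *\<^sub>R sgn w))\<^sup>2"
        unfolding e dw using q False by (simp add: norm_sgn)
    qed
    then show ?thesis unfolding v using e by simp
  qed
  then show ?thesis unfolding chart_def b w_def by simp
qed

lemma continuous_on_chart: "continuous_on chart_dom chart"
proof -
  have b: "continuous_on chart_dom (\<lambda>x. base (p x))"
    using chart_split(1,2) by (intro continuous_on_compose2[OF continuous_on_base] continuous_intros) auto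
  have "continuous_on chart_dom (\<lambda>x. h (base (p x)))"
    using chart_split(4) by (intro continuous_on_compose2[OF continuous_on_h] b) auto
  moreover have "continuous_on chart_dom (\<lambda>x. (\<lambda>(u, v). stretch u v *\<^sub>R v) (base (p x), x - p x))"
    using chart_split(3,4)
    by (intro continuous_on_compose2[OF continuous_on_stretch] continuous_intros b) auto
  ultimately show ?thesis unfolding chart_def[abs_def] using b by (auto intro!: continuous_intros)
qed

lemma continuous_on_J_p: "continuous_on {y. R1 < norm (p y)} (\<lambda>y. J (p y))"
  using p(2) by (intro continuous_on_compose2[OF continuous_on_J] continuous_intros) (auto simp: far_def)

lemma chart_img_norm: "y \<in> chart_img \<Longrightarrow> R < norm y"
  using norm_fiber[OF p(2) p(3), of y y] R by (auto simp: chart_img_def)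

lemma continuous_on_inv_chart: "continuous_on chart_img inv_chart"
proof -
  have J: "continuous_on chart_img (\<lambda>y. J (p y))"
    by (rule continuous_on_subset[OF continuous_on_J_p]) (auto simp: chart_img_def)
  have h: "continuous_on chart_img (\<lambda>y. h (p y))"
    using chart_img_far by (intro continuous_on_compose2[OF continuous_on_h] continuous_intros) auto
  have L: "continuous_on chart_img L"
    by (rule continuous_on_subset[OF L_cont]) (auto dest: chart_img_norm)
  show ?thesis
    unfolding inv_chart_def[abs_def]
  proof (intro continuous_on_add continuous_on_scaleR_sgn continuous_intros J L h)
    fix y assume y: "y \<in> chart_img"
    { assume "p y = 0"
      then show "sqrt (J (p y)) = 0" using y R1_pos by (simp add: chart_img_def) }
    { assume "y - p y - h (p y) = 0"
      then have "y = p y + h (p y)" by (metis add_diff_cancel_left' add.commute diff_add_cancel eq_iff_diff_eq_0)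
      then have "L y = J (p y)" unfolding J_def by simp
      then show "sqrt (J (p y) - L y) = 0" by simp }
  qed
qed

lemma open_chart_img: "open chart_img"
proof -
  have "open {y. R1 < norm (p y)}" by (intro open_Collect_less continuous_intros)
  then have "open ({y. R1 < norm (p y)} \<inter> (\<lambda>y. J (p y)) -` {r0\<^sup>2<..})"
    by (intro continuous_open_preimage continuous_on_J_p) auto
  moreover have "{y. R1 < norm (p y)} \<inter> (\<lambda>y. J (p y)) -` {r0\<^sup>2<..} = chart_img"
    by (auto simp: chart_img_def)
  ultimately show ?thesis by simp
qed

lemma chart_image: "chart ` chart_dom = chart_img"
  using chart_in_img chart_inv_chart inv_chart_in_dom by force

lemma chart_homeo: "homeomorphism chart_dom (chart ` chart_dom) chart inv_chart"
  unfolding homeomorphism_def chart_image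
  using inv_chart_chart chart_inv_chart continuous_on_chart continuous_on_inv_chart chart_in_img
    inv_chart_in_dom chart_image
  by (force simp: image_iff)

lemma chart_dom_eq: "chart_dom = {u + v | u v. u \<in> ball_infty M r0 \<and> v \<in> N}"
proof (intro subset_antisym subsetI)
  fix x assume "x \<in> chart_dom"
  then have "p x \<in> ball_infty M r0" "x = p x + (x - p x)" by (auto simp: chart_dom_def ball_infty_def p)
  then show "x \<in> {u + v | u v. u \<in> ball_infty M r0 \<and> v \<in> N}" using p(3) by blast
qed (auto simp: chart_dom_def ball_infty_def p_split)

lemma chart_norm_bounds:
  assumes u: "u \<in> M" "r0 < norm u" and v: "v \<in> N"
  shows "norm u / sqrt (2 * norm T) \<le> norm (p (chart (u + v)))"
    "norm (p (chart (u + v))) \<le> norm u / sqrt (a - l)"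
proof -
  have x: "u + v \<in> chart_dom" using u v by (simp add: chart_dom_def p_split)
  have e: "p (chart (u + v)) = base u" using chart_split(6)[OF x] u v by (simp add: p_split)
  have J: "J (base u) = (norm u)\<^sup>2" and f: "base u \<in> far" using J_base base_far u by auto
  have "(a - l) * (norm (base u))\<^sup>2 \<le> (norm u)\<^sup>2" using J_bounds(1)[OF f] J by simp
  then have "(norm (base u))\<^sup>2 \<le> (norm u / sqrt (a - l))\<^sup>2"
    using l by (simp add: power_divide field_simps)
  then show "norm (p (chart (u + v))) \<le> norm u / sqrt (a - l)"
    unfolding e by (rule power2_le_imp_le) (use l in simp)
  have u0: "0 < norm u" using u r0_pos by linarith
  have aT: "2 * a \<le> norm T"
  proof -
    have "2 * a * (norm u)\<^sup>2 \<le> norm T * (norm u)\<^sup>2"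
      using T_pos[OF u(1)] b_upper[of u] by (simp add: b_def)
    then show ?thesis using u0 by simp
  qed
  have "0 < norm T" using aT l by linarith
  have "(norm u)\<^sup>2 \<le> C * (norm (base u))\<^sup>2" using J_bounds(2)[OF f] J by simp
  also have "\<dots> \<le> 2 * norm T * (norm (base u))\<^sup>2"
    unfolding C_def using aT l by (intro mult_right_mono) auto
  finally have "(norm u / sqrt (2 * norm T))\<^sup>2 \<le> (norm (base u))\<^sup>2"
    using \<open>0 < norm T\<close> by (simp add: power_divide field_simps)
  then show "norm u / sqrt (2 * norm T) \<le> norm (p (chart (u + v)))"
    unfolding e by (rule power2_le_imp_le) simp
qed

text \<open>The image of the chart contains the whole fibre over a suitable point of \<open>M\<close>; a nonzero \<open>M\<close> is
needed for such a point to exist.\<close>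

lemma chart_img_covers_N:
  assumes "M \<noteq> {0}"
  shows "(\<lambda>y. y - p y) ` chart ` chart_dom = N"
proof
  show "(\<lambda>y. y - p y) ` chart ` chart_dom \<subseteq> N" using p(3) by blast
  obtain e where e: "e \<in> M" "e \<noteq> 0" using assms subspaces(1) subspace_0 by blast
  define u where "u = (r0 + 1) *\<^sub>R sgn e"
  have u: "u \<in> M" "r0 < norm u"
    unfolding u_def using sgn_direction[OF e] subspaces r0_pos by (auto simp: subspace_scale)
  have f: "base u \<in> far" and b: "norm (base u) = radius u" using base_far u by auto
  show "N \<subseteq> (\<lambda>y. y - p y) ` chart ` chart_dom"
  proof
    fix v assume v: "v \<in> N"
    have pv: "p (base u + v) = base u" using farD(1)[OF f] v by (rule p_split)
    then have "base u + v \<in> chart_img"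
      using u radius_gt[OF u] b J_base[OF u] r0_pos
      by (auto simp: chart_img_def intro!: power_strict_mono)
    then show "v \<in> (\<lambda>y. y - p y) ` chart ` chart_dom"
      unfolding chart_image using pv by (intro image_eqI[of _ _ "base u + v"]) auto
  qed
qed

theorem saddle_chart:
  shows "\<exists>r>0. \<exists>\<phi> \<psi>. open (\<phi> ` {u + v | u v. u \<in> ball_infty M r \<and> v \<in> N}) \<and>
    \<phi> ` {u + v | u v. u \<in> ball_infty M r \<and> v \<in> N} \<subseteq> {x. R < norm x} \<and>
    homeomorphism {u + v | u v. u \<in> ball_infty M r \<and> v \<in> N}
      (\<phi> ` {u + v | u v. u \<in> ball_infty M r \<and> v \<in> N}) \<phi> \<psi> \<and>
    (\<forall>u\<in>ball_infty M r. \<forall>v\<in>N. L (\<phi> (u + v)) = (norm u)\<^sup>2 - (norm v)\<^sup>2 \<and>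
      norm u / sqrt (2 * norm T) \<le> norm (p (\<phi> (u + v))) \<and>
      norm (p (\<phi> (u + v))) \<le> norm u / sqrt (a - l)) \<and>
    (M \<noteq> {0} \<longrightarrow> (\<lambda>y. y - p y) ` \<phi> ` {u + v | u v. u \<in> ball_infty M r \<and> v \<in> N} = N)"
proof (rule exI[of _ r0], intro conjI, rule r0_pos, rule exI[of _ chart], rule exI[of _ inv_chart],
    unfold chart_dom_eq[symmetric], intro conjI)
  show "open (chart ` chart_dom)" unfolding chart_image by (rule open_chart_img)
  show "chart ` chart_dom \<subseteq> {x. R < norm x}" unfolding chart_image using chart_img_norm by blast
  show "\<forall>u\<in>ball_infty M r0. \<forall>v\<in>N. L (chart (u + v)) = (norm u)\<^sup>2 - (norm v)\<^sup>2 \<and>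
      norm u / sqrt (2 * norm T) \<le> norm (p (chart (u + v))) \<and>
      norm (p (chart (u + v))) \<le> norm u / sqrt (a - l)"
  proof (intro ballI conjI)
    fix u v assume u: "u \<in> ball_infty M r0" and v: "v \<in> N"
    then have uM: "u \<in> M" "r0 < norm u" by (auto simp: ball_infty_def)
    have "u + v \<in> chart_dom" using uM v by (simp add: chart_dom_def p_split)
    from chart_split(7)[OF this] show "L (chart (u + v)) = (norm u)\<^sup>2 - (norm v)\<^sup>2"
      using uM v by (simp add: p_split)
  qed (use chart_norm_bounds in \<open>auto simp: ball_infty_def\<close>)
qed (use chart_homeo chart_img_covers_N in blast)+

end

section \<open>Directional derivatives along lines\<close>

lemma has_dir_deriv_dir_deriv:
  assumes "cont_dir_differentiable_on U f" "x \<in> U"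
  shows "has_dir_deriv f x u (dir_deriv f x u)"
proof -
  obtain d where d: "has_dir_deriv f x u d"
    using assms unfolding cont_dir_differentiable_on_def by blast
  have "e = d" if "has_dir_deriv f x u e" for e
    using d that unfolding has_dir_deriv_def by (intro tendsto_unique) auto
  with d have "dir_deriv f x u = d" unfolding dir_deriv_def by blast
  with d show ?thesis by simp
qed

text \<open>Along a line in direction \<open>u\<close> a directional derivative is an ordinary derivative.  The functional
\<open>\<Lambda>\<close> makes real functions out of maps with values in a normed space.\<close>

lemma DERIV_line:
  fixes f :: "'a::real_normed_vector \<Rightarrow> 'b::real_normed_vector"
  assumes "has_dir_deriv f (x + t *\<^sub>R u) u d" and "bounded_linear \<Lambda>"
  shows "((\<lambda>s. \<Lambda> (f (x + s *\<^sub>R u))) has_real_derivative \<Lambda> d) (at t)"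
  unfolding DERIV_def
proof -
  interpret \<Lambda>: bounded_linear \<Lambda> by fact
  have "((\<lambda>s. \<Lambda> ((f (x + t *\<^sub>R u + s *\<^sub>R u) - f (x + t *\<^sub>R u)) /\<^sub>R s)) \<longlongrightarrow> \<Lambda> d) (at 0)"
    using assms(1) unfolding has_dir_deriv_def by (rule \<Lambda>.tendsto)
  then show "((\<lambda>s. (\<Lambda> (f (x + (t + s) *\<^sub>R u)) - \<Lambda> (f (x + t *\<^sub>R u))) / s) \<longlongrightarrow> \<Lambda> d) (at 0)"
    by (simp add: \<Lambda>.scaleR \<Lambda>.diff scaleR_add_left add.assoc divide_inverse mult.commute)
qed

lemma DERIV_quadratic_form_line:
  fixes T :: "'h::real_inner \<Rightarrow>\<^sub>L 'h"
  assumes "self_adjoint T"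
  shows "((\<lambda>s. 1/2 * inner (T (x + s *\<^sub>R d)) (x + s *\<^sub>R d)) has_real_derivative
    inner (T (x + t *\<^sub>R d)) d) (at t)"
proof -
  have sym: "inner (T d) x = inner (T x) d"
    using assms unfolding self_adjoint_def by (simp add: inner_commute)
  have "(\<lambda>s. 1/2 * inner (T (x + s *\<^sub>R d)) (x + s *\<^sub>R d)) =
      (\<lambda>s. 1/2 * inner (T x) x + s * inner (T x) d + 1/2 * s\<^sup>2 * inner (T d) d)"
    by (rule ext) (simp add: blinfun.add_right blinfun.scaleR_right inner_add_left inner_add_right sym
        power2_eq_square algebra_simps)
  moreover have "((\<lambda>s. 1/2 * inner (T x) x + s * inner (T x) d + 1/2 * s\<^sup>2 * inner (T d) d)
      has_real_derivative inner (T x) d + t * inner (T d) d) (at t)"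
    by (auto intro!: derivative_eq_intros)
  ultimately show ?thesis
    by (simp add: blinfun.add_right blinfun.scaleR_right inner_add_left)
qed

section \<open>Estimates on the dense subspace\<close>

locale dense_inclusion =
  fixes j :: "'x::real_normed_vector \<Rightarrow> 'h::{real_inner,complete_space}"
  assumes lin: "linear j" and dense: "closure (range j) = UNIV" and contr: "\<And>x. norm (j x) \<le> norm x"
begin

lemma bounded_linear_j: "bounded_linear j"
  using lin contr by (intro bounded_linear_intro[of _ 1]) (auto simp: linear_add linear_scale)

lemmas j_simps = linear_add[OF lin] linear_diff[OF lin] linear_scale[OF lin]

lemma approximating_sequence:
  obtains xs :: "nat \<Rightarrow> 'x" where "(\<lambda>n. j (xs n)) \<longlonglongrightarrow> y"
proof -
  have "y \<in> closure (range j)" using dense by simp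
  then obtain ys where "\<And>n. ys n \<in> range j" "ys \<longlonglongrightarrow> y" unfolding closure_sequential by blast
  then have "\<exists>xs. \<forall>n. ys n = j (xs n)" by (intro choice) auto
  then obtain xs where "ys = (\<lambda>n. j (xs n))" by blast
  with \<open>ys \<longlonglongrightarrow> y\<close> that show ?thesis by blast
qed

end

text \<open>The analytic hypotheses: \<open>A\<close> is the gradient of \<open>L\<close> on the dense subspace, \<open>B\<close> its derivative, and
\<open>Binf\<close> the limit of \<open>B\<close> at infinity.\<close>

locale asymptotically_quadratic = dense_inclusion j
  for j :: "'x::real_normed_vector \<Rightarrow> 'h::{real_inner,complete_space}" +
  fixes V :: "'h set" and L :: "'h \<Rightarrow> real" and A :: "'x \<Rightarrow> 'x"
    and B P Q :: "'x \<Rightarrow> ('h \<Rightarrow>\<^sub>L 'h)" and Binf Pinf Qinf :: "'h \<Rightarrow>\<^sub>L 'h" and a l R :: real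
  assumes L_cont: "continuous_on V L"
    and L_diff: "cont_dir_differentiable_on V L"
    and A_diff: "cont_dir_differentiable_on (j -` V) A"
    and L_gradient: "\<And>x u. j x \<in> V \<Longrightarrow> dir_deriv L (j x) (j u) = inner (j (A x)) (j u)"
    and Binf_sa: "self_adjoint Binf"
    and A_deriv: "\<And>x u v. j x \<in> V \<Longrightarrow> inner (j (dir_deriv A x u)) (j v) = inner (B x (j u)) (j v)"
    and decomp: "\<And>x. j x \<in> V \<Longrightarrow> B x = P x + Q x" "Binf = Pinf + Qinf"
    and Qinf: "compact_op Qinf"
    and neg_eigenvectors: "\<And>c u. c < 0 \<Longrightarrow> Binf u = c *\<^sub>R u \<Longrightarrow> u \<in> range j"
    and P_limit: "\<And>xs::nat \<Rightarrow> 'x. (\<And>k. j (xs k) \<in> V) \<Longrightarrow>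
      filterlim (\<lambda>k. norm (j (xs k))) at_top sequentially \<Longrightarrow> (\<lambda>k. norm (P (xs k) u - Pinf u)) \<longlonglongrightarrow> 0"
    and Q_limit: "\<And>e. e > 0 \<Longrightarrow> \<exists>r. \<forall>x. j x \<in> V \<longrightarrow> norm (j x) > r \<longrightarrow> norm (Q x - Qinf) < e"
    and P_coercive: "\<And>xs::nat \<Rightarrow> 'x. (\<And>k. j (xs k) \<in> V) \<Longrightarrow>
      filterlim (\<lambda>k. norm (j (xs k))) at_top sequentially \<Longrightarrow>
      \<exists>C0>0. \<exists>n0. \<forall>n\<ge>n0. \<forall>u. inner (P (xs n) u) u \<ge> C0 * (norm u)\<^sup>2"
    and pos_form: "\<And>u. u \<in> pos_subspace Binf \<Longrightarrow> 2 * a * (norm u)\<^sup>2 \<le> inner (Binf u) u"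
    and neg_form: "\<And>u. u \<in> neg_subspace Binf \<Longrightarrow> inner (Binf u) u \<le> - 2 * a * (norm u)\<^sup>2"
    and ker: "\<And>u. Binf u = 0 \<Longrightarrow> u = 0"
    and R: "0 < R" "\<And>x. R \<le> norm x \<Longrightarrow> x \<in> V"
    and l: "0 < l" "l < a"
    and L_bound: "\<And>u. R \<le> norm u \<Longrightarrow> \<bar>L u - 1/2 * inner (Binf u) u\<bar> \<le> l * (norm u)\<^sup>2"
    and A_bound: "\<And>x. R \<le> norm (j x) \<Longrightarrow> norm (j (A x) - Binf (j x)) \<le> l * norm (j x)"
begin

text \<open>The coercivity constant along one sequence going to infinity survives in the strong limit.  Such a
sequence exists by density, unless the space is trivial.\<close>

lemma Pinf_coercive: "\<exists>C0>0. \<forall>u. C0 * (norm u)\<^sup>2 \<le> inner (Pinf u) u"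
proof (cases "\<forall>u::'h. u = 0")
  case True
  then show ?thesis by (metis inner_zero_right mult_zero_right norm_zero order_refl zero_less_one zero_power2)
next
  case False
  then obtain w :: 'h where w: "w \<noteq> 0" by blast
  have "\<exists>x. R + real k < norm (j x)" for k
  proof -
    obtain xs where xs: "(\<lambda>n. j (xs n)) \<longlonglongrightarrow> (R + real k + 1) *\<^sub>R sgn w"
      by (rule approximating_sequence)
    have "norm ((R + real k + 1) *\<^sub>R sgn w) = R + real k + 1" using R(1) w by (simp add: norm_sgn)
    with tendsto_norm[OF xs] have "(\<lambda>n. norm (j (xs n))) \<longlonglongrightarrow> R + real k + 1" by simp
    then have "\<forall>\<^sub>F n in sequentially. R + real k < norm (j (xs n))" by (rule order_tendstoD) simp
    then show ?thesis by (auto simp: eventually_sequentially)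
  qed
  then have "\<exists>xs. \<forall>k. R + real k < norm (j (xs k))" by (intro choice) auto
  then obtain xs where xs: "\<And>k. R + real k < norm (j (xs k))" by blast
  have V: "j (xs k) \<in> V" for k using xs[of k] by (intro R(2)) linarith
  have lim: "filterlim (\<lambda>k. norm (j (xs k))) at_top sequentially"
    using filterlim_real_sequentially
    by (rule filterlim_at_top_mono) (use xs R(1) in \<open>auto intro!: always_eventually less_imp_le less_trans[OF _ xs]\<close>)
  obtain C0 n0 where C0: "C0 > 0" "\<And>n u. n \<ge> n0 \<Longrightarrow> C0 * (norm u)\<^sup>2 \<le> inner (P (xs n) u) u"
    using P_coercive[OF V lim] by blast
  have "C0 * (norm u)\<^sup>2 \<le> inner (Pinf u) u" for u
  proof (rule tendsto_lowerbound)
    have "(\<lambda>k. P (xs k) u) \<longlonglongrightarrow> Pinf u" by (rule LIM_zero_cancel[OF tendsto_norm_zero_cancel[OF P_limit[OF V lim]]])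
    then show "(\<lambda>k. inner (P (xs k) u) u) \<longlonglongrightarrow> inner (Pinf u) u" by (intro tendsto_inner tendsto_const)
    show "\<forall>\<^sub>F k in sequentially. C0 * (norm u)\<^sup>2 \<le> inner (P (xs k) u) u"
      using C0(2) by (auto simp: eventually_sequentially)
  qed simp
  then show ?thesis using C0(1) by blast
qed

text \<open>The sequential hypothesis on \<open>P\<close> is turned into a statement about all points far out, with the
radius depending on the vector \<open>u\<close>.\<close>

lemma B_converges_strongly:
  assumes "e > 0"
  shows "\<exists>r. \<forall>x. j x \<in> V \<longrightarrow> r < norm (j x) \<longrightarrow> norm (B x u - Binf u) < e"
proof -
  have "\<exists>r. \<forall>x. j x \<in> V \<longrightarrow> r < norm (j x) \<longrightarrow> norm (P x u - Pinf u) < e / 2"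
  proof (rule ccontr)
    assume "\<not> ?thesis"
    then have "\<forall>k::nat. \<exists>x. j x \<in> V \<and> real k < norm (j x) \<and> e / 2 \<le> norm (P x u - Pinf u)"
      by (meson not_le)
    from choice[OF this] obtain xs
      where xs: "\<And>k. j (xs k) \<in> V" "\<And>k. real k < norm (j (xs k))" "\<And>k. e / 2 \<le> norm (P (xs k) u - Pinf u)"
      by blast
    have lim: "filterlim (\<lambda>k. norm (j (xs k))) at_top sequentially"
      using filterlim_real_sequentially
      by (rule filterlim_at_top_mono) (use xs(2) in \<open>auto intro!: always_eventually less_imp_le\<close>)
    have "e / 2 \<le> 0"
      using P_limit[OF xs(1) lim, of u] by (rule LIMSEQ_le_const) (use xs(3) in blast)
    then show False using assms by simp
  qed
  then obtain r1 where r1: "\<And>x. j x \<in> V \<Longrightarrow> r1 < norm (j x) \<Longrightarrow> norm (P x u - Pinf u) < e / 2"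
    by blast
  have ep: "0 < e / (2 * (norm u + 1))" using assms by (simp add: add_nonneg_pos)
  from Q_limit[OF this] obtain r2
    where r2: "\<And>x. j x \<in> V \<Longrightarrow> r2 < norm (j x) \<Longrightarrow> norm (Q x - Qinf) < e / (2 * (norm u + 1))"
    by blast
  have "norm (B x u - Binf u) < e" if x: "j x \<in> V" "max r1 r2 < norm (j x)" for x
  proof -
    have "norm ((Q x - Qinf) u) \<le> norm (Q x - Qinf) * norm u" by (rule norm_blinfun)
    also have "\<dots> \<le> e / (2 * (norm u + 1)) * (norm u + 1)"
      using less_imp_le[OF r2[of x]] x less_imp_le[OF ep] by (intro mult_mono) simp_all
    also have "\<dots> = e / 2" by (simp add: field_simps add_nonneg_eq_0_iff)
    finally have "norm (Q x u - Qinf u) \<le> e / 2" by (simp add: blinfun.diff_left)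
    moreover have "norm (P x u - Pinf u) < e / 2" using r1 x by simp
    moreover have eq: "B x u - Binf u = (P x u - Pinf u) + (Q x u - Qinf u)"
      using decomp x by (simp add: blinfun.add_left)
    ultimately show ?thesis unfolding eq using norm_triangle_ineq[of "P x u - Pinf u" "Q x u - Qinf u"] by linarith
  qed
  then show ?thesis by blast
qed

text \<open>Strong convergence is uniform on a finite-dimensional subspace: it suffices to take the largest of
the radii belonging to the basis vectors.\<close>

lemma B_negative_on_span:
  assumes E: "finite E" "orthonormal_set E" "neg_subspace Binf = span E"
  obtains R' where "R \<le> R'"
    "\<And>x v. R' \<le> norm (j x) \<Longrightarrow> v \<in> span E \<Longrightarrow> inner (B x v) v \<le> - a * (norm v)\<^sup>2"
proof -
  \<comment> \<open>An error \<open>e\<close> for each basis vector adds up to at most half of the negativity \<open>2 * a\<close> of \<open>Binf\<close>.\<close>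
  define e where "e = a / (real (card E) + 1)"
  have e: "0 < e" "real (card E) * e \<le> a" unfolding e_def using l by (auto simp: field_simps)
  have "\<forall>f. \<exists>r. \<forall>x. j x \<in> V \<longrightarrow> r < norm (j x) \<longrightarrow> norm (B x f - Binf f) < e"
    using B_converges_strongly[OF e(1)] by blast
  from choice[OF this] obtain r
    where r: "\<And>f x. j x \<in> V \<Longrightarrow> r f < norm (j x) \<Longrightarrow> norm (B x f - Binf f) < e" by blast
  define R' where "R' = Max (insert R (r ` E)) + 1"
  have R': "R \<le> R'" "\<And>f. f \<in> E \<Longrightarrow> r f < R'"
  proof -
    have "R \<le> Max (insert R (r ` E))" "\<And>f. f \<in> E \<Longrightarrow> r f \<le> Max (insert R (r ` E))"
      using E(1) by auto
    then show "R \<le> R'" "\<And>f. f \<in> E \<Longrightarrow> r f < R'" unfolding R'_def by force+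
  qed
  have "inner (B x v) v \<le> - a * (norm v)\<^sup>2" if x: "R' \<le> norm (j x)" and v: "v \<in> span E" for x v
  proof -
    have xV: "j x \<in> V" using R'(1) x by (intro R(2)) simp
    have "v = (\<Sum>f\<in>E. inner v f *\<^sub>R f)"
      using orthonormal_expansion_span[OF E(1,2) v] unfolding orthonormal_expansion_def by simp
    then have "(B x - Binf) v = (B x - Binf) (\<Sum>f\<in>E. inner v f *\<^sub>R f)" by (rule arg_cong)
    then have "(B x - Binf) v = (\<Sum>f\<in>E. inner v f *\<^sub>R (B x f - Binf f))"
      by (simp add: blinfun.sum_right blinfun.scaleR_right blinfun.diff_left)
    then have "norm ((B x - Binf) v) \<le> (\<Sum>f\<in>E. norm (inner v f *\<^sub>R (B x f - Binf f)))"
      by (simp only: norm_sum)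
    also have "\<dots> \<le> (\<Sum>f\<in>E. norm v * e)"
    proof (rule sum_mono)
      fix f assume f: "f \<in> E"
      have "\<bar>inner v f\<bar> \<le> norm v"
        using Cauchy_Schwarz_ineq2[of v f] E(2) f unfolding orthonormal_set_def by simp
      moreover have "norm (B x f - Binf f) \<le> e" using r[OF xV] R'(2)[OF f] x by (auto intro: less_imp_le)
      ultimately show "norm (inner v f *\<^sub>R (B x f - Binf f)) \<le> norm v * e"
        by (simp add: mult_mono)
    qed
    also have "\<dots> = (real (card E) * e) * norm v" by simp
    also have "\<dots> \<le> a * norm v" using e(2) by (rule mult_right_mono) simp
    finally have "norm ((B x - Binf) v) * norm v \<le> a * (norm v)\<^sup>2"
      by (simp add: power2_eq_square mult_right_mono flip: mult.assoc)
    moreover have "inner ((B x - Binf) v) v \<le> norm ((B x - Binf) v) * norm v" by (rule norm_cauchy_schwarz)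
    moreover have "inner (B x v) v = inner (Binf v) v + inner ((B x - Binf) v) v"
      by (simp add: blinfun.diff_left inner_diff_left)
    ultimately show ?thesis using neg_form[of v] v E(3) by simp
  qed
  then show ?thesis using that R'(1) by blast
qed

lemma DERIV_L_line:
  assumes "j (x + t *\<^sub>R d) \<in> V"
  shows "((\<lambda>s. L (j x + s *\<^sub>R j d)) has_real_derivative inner (j (A (x + t *\<^sub>R d))) (j d)) (at t)"
proof -
  have "has_dir_deriv L (j x + t *\<^sub>R j d) (j d) (inner (j (A (x + t *\<^sub>R d))) (j d))"
    using has_dir_deriv_dir_deriv[OF L_diff assms, of "j d"] L_gradient[OF assms] by (simp add: j_simps)
  then show ?thesis using DERIV_line[of L "j x" t "j d" _ "\<lambda>y. y"] bounded_linear_ident by simp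
qed

text \<open>The mean value theorem for \<open>L - b\<close> on the segment, which lies in a half-space outside the ball of
radius \<open>R\<close>.\<close>

lemma L_segment_dense:
  assumes w: "norm w \<le> 1" "R < inner (j x) w" "R < inner (j y) w"
  shows "\<bar>(L (j y) - 1/2 * inner (Binf (j y)) (j y)) - (L (j x) - 1/2 * inner (Binf (j x)) (j x))\<bar>
    \<le> l * max (norm (j x)) (norm (j y)) * norm (j y - j x)"
proof -
  define d where "d = y - x"
  let ?K = "max (norm (j x)) (norm (j y))"
  define g where "g t = L (j x + t *\<^sub>R j d) - 1/2 * inner (Binf (j x + t *\<^sub>R j d)) (j x + t *\<^sub>R j d)" for t
  define g' where "g' t = inner (j (A (x + t *\<^sub>R d))) (j d) - inner (Binf (j x + t *\<^sub>R j d)) (j d)" for t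
  have pt: "j (x + t *\<^sub>R d) = (1 - t) *\<^sub>R j x + t *\<^sub>R j y" for t
    unfolding d_def by (simp add: j_simps algebra_simps)
  have far: "R \<le> norm (j (x + t *\<^sub>R d))" if t: "0 \<le> t" "t \<le> 1" for t
  proof -
    have "(1 - t) * R + t * R \<le> (1 - t) * inner (j x) w + t * inner (j y) w"
      using t w by (intro add_mono mult_left_mono) auto
    then have "R \<le> inner (j (x + t *\<^sub>R d)) w"
      unfolding pt by (simp add: inner_add_left algebra_simps)
    also have "\<dots> \<le> norm (j (x + t *\<^sub>R d)) * norm w" by (rule norm_cauchy_schwarz)
    also have "\<dots> \<le> norm (j (x + t *\<^sub>R d))" using w(1) by (simp add: mult_left_le)
    finally show ?thesis .
  qed
  have "DERIV g t :> g' t" if "0 \<le> t" "t \<le> 1" for t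
    unfolding g_def g'_def
    by (intro DERIV_diff DERIV_L_line DERIV_quadratic_form_line Binf_sa R(2) far that)
  then obtain z where z: "0 < z" "z < 1" "g 1 - g 0 = g' z"
    using MVT2[of 0 1 g g'] by auto
  have "\<bar>g' z\<bar> = \<bar>inner (j (A (x + z *\<^sub>R d)) - Binf (j (x + z *\<^sub>R d))) (j d)\<bar>"
    unfolding g'_def by (simp add: inner_diff_left j_simps)
  also have "\<dots> \<le> norm (j (A (x + z *\<^sub>R d)) - Binf (j (x + z *\<^sub>R d))) * norm (j d)"
    by (rule Cauchy_Schwarz_ineq2)
  also have "\<dots> \<le> (l * ?K) * norm (j d)"
  proof (rule mult_right_mono)
    have "norm (j (x + z *\<^sub>R d)) \<le> (1 - z) * norm (j x) + z * norm (j y)"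
      unfolding pt using z by (intro order_trans[OF norm_triangle_ineq]) simp
    also have "\<dots> \<le> (1 - z) * ?K + z * ?K" using z by (intro add_mono mult_left_mono) auto
    finally have "norm (j (x + z *\<^sub>R d)) \<le> ?K" by (simp add: algebra_simps)
    then have "l * norm (j (x + z *\<^sub>R d)) \<le> l * ?K" using l by (intro mult_left_mono) auto
    then show "norm (j (A (x + z *\<^sub>R d)) - Binf (j (x + z *\<^sub>R d))) \<le> l * ?K"
      using A_bound[OF far[of z]] z by auto
  qed simp
  finally have "\<bar>g 1 - g 0\<bar> \<le> (l * ?K) * norm (j d)" using z(3) by simp
  then show ?thesis unfolding g_def d_def by (simp add: j_simps)
qed

text \<open>The second derivative of \<open>s \<mapsto> L (j x + s v)\<close> is the form of \<open>B\<close> at \<open>v\<close>, so that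
\<open>- L - a/2 * (s * norm v)\<^sup>2\<close> is convex in \<open>s\<close>.\<close>

lemma L_concave_dense:
  assumes v: "j w = v" and far: "\<And>t. 0 \<le> t \<Longrightarrow> t \<le> 1 \<Longrightarrow> R \<le> norm (j x + t *\<^sub>R v)"
    and neg: "\<And>t. 0 \<le> t \<Longrightarrow> t \<le> 1 \<Longrightarrow> inner (B (x + t *\<^sub>R w) v) v \<le> - a * (norm v)\<^sup>2"
    and t: "0 \<le> t" "t \<le> 1"
  shows "(1 - t) * L (j x) + t * L (j x + v) + a/2 * (t * (1 - t)) * (norm v)\<^sup>2 \<le> L (j x + t *\<^sub>R v)"
proof -
  let ?q = "a * (norm v)\<^sup>2"
  define G where "G s = - L (j x + s *\<^sub>R v) - 1/2 * s\<^sup>2 * ?q" for s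
  define G' where "G' s = - inner (j (A (x + s *\<^sub>R w))) v - s * ?q" for s
  define G'' where "G'' s = - inner (B (x + s *\<^sub>R w) v) v - ?q" for s
  have V: "j (x + s *\<^sub>R w) \<in> V" if "s \<in> {0..1}" for s
    using far[of s] that v by (intro R(2)) (simp add: j_simps)
  have "convex_on {0..1} G"
  proof (rule f''_ge0_imp_convex)
    show "convex {0..1::real}" by simp
    fix s :: real assume s: "s \<in> {0..1}"
    have "((\<lambda>s. L (j x + s *\<^sub>R v)) has_real_derivative inner (j (A (x + s *\<^sub>R w))) v) (at s)"
      using DERIV_L_line[OF V[OF s]] v by simp
    then show "DERIV G s :> G' s"
      unfolding G_def G'_def by (auto intro!: derivative_eq_intros)
    have "has_dir_deriv A (x + s *\<^sub>R w) w (dir_deriv A (x + s *\<^sub>R w) w)"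
      using V[OF s] by (intro has_dir_deriv_dir_deriv[OF A_diff]) simp
    from DERIV_line[OF this, of "\<lambda>y. inner (j y) v"]
    have "((\<lambda>s. inner (j (A (x + s *\<^sub>R w))) v) has_real_derivative inner (B (x + s *\<^sub>R w) v) v) (at s)"
      using bounded_linear_compose[OF bounded_linear_inner_left bounded_linear_j, of v]
        A_deriv[OF V[OF s], of w w] v by simp
    then show "DERIV G' s :> G'' s"
      unfolding G'_def G''_def by (auto intro!: derivative_eq_intros)
    show "0 \<le> G'' s" using neg[of s] s unfolding G''_def by simp
  qed
  from convex_onD[OF this t, of 0 1] have "G t \<le> (1 - t) * G 0 + t * G 1" by simp
  then have "(1 - t) * L (j x) + t * L (j x + v) + (1/2 * t * ?q - 1/2 * t\<^sup>2 * ?q) \<le> L (j x + t *\<^sub>R v)"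
    unfolding G_def by (simp add: algebra_simps)
  moreover have "1/2 * t * ?q - 1/2 * t\<^sup>2 * ?q = a/2 * (t * (1 - t)) * (norm v)\<^sup>2"
    by (simp add: power2_eq_square algebra_simps)
  ultimately show ?thesis by simp
qed

lemma tendsto_L: "(\<lambda>n. L (y n)) \<longlonglongrightarrow> L z" if "y \<longlonglongrightarrow> z" "R < norm z"
proof -
  have "\<forall>\<^sub>F n in sequentially. R < norm (y n)"
    using tendsto_norm[OF that(1)] that(2) by (rule order_tendstoD)
  then have "\<forall>\<^sub>F n in sequentially. y n \<in> V" by eventually_elim (auto intro: R(2) less_imp_le)
  moreover have "z \<in> V" using that(2) by (intro R(2)) simp
  ultimately show ?thesis using continuous_on_tendsto_compose[OF L_cont that(1)] by blast
qed

lemma L_segment: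
  assumes w: "norm w \<le> 1" "R < inner x w" "R < inner y w"
  shows "\<bar>(L y - 1/2 * inner (Binf y) y) - (L x - 1/2 * inner (Binf x) x)\<bar>
    \<le> l * max (norm x) (norm y) * norm (y - x)"
proof -
  obtain xs ys where xs: "(\<lambda>n. j (xs n)) \<longlonglongrightarrow> x" and ys: "(\<lambda>n. j (ys n)) \<longlonglongrightarrow> y"
    using approximating_sequence by metis
  have nw: "R < norm z" if "R < inner z w" for z
  proof -
    have "inner z w \<le> norm z * norm w" by (rule norm_cauchy_schwarz)
    also have "\<dots> \<le> norm z" using w(1) by (simp add: mult_left_le)
    finally show ?thesis using that by simp
  qed
  have ev: "\<forall>\<^sub>F n in sequentially. R < inner (j (xs n)) w" "\<forall>\<^sub>F n in sequentially. R < inner (j (ys n)) w"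
    using order_tendstoD(1)[OF tendsto_inner[OF xs tendsto_const] w(2)]
      order_tendstoD(1)[OF tendsto_inner[OF ys tendsto_const] w(3)] by auto
  show ?thesis
  proof (rule tendsto_le[OF sequentially_bot])
    show "(\<lambda>n. l * max (norm (j (xs n))) (norm (j (ys n))) * norm (j (ys n) - j (xs n)))
        \<longlonglongrightarrow> l * max (norm x) (norm y) * norm (y - x)"
      by (intro tendsto_intros xs ys)
    show "(\<lambda>n. \<bar>(L (j (ys n)) - 1/2 * inner (Binf (j (ys n))) (j (ys n))) -
          (L (j (xs n)) - 1/2 * inner (Binf (j (xs n))) (j (xs n)))\<bar>)
        \<longlonglongrightarrow> \<bar>(L y - 1/2 * inner (Binf y) y) - (L x - 1/2 * inner (Binf x) x)\<bar>"
      by (intro tendsto_intros tendsto_L xs ys nw w)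
    show "\<forall>\<^sub>F n in sequentially. \<bar>(L (j (ys n)) - 1/2 * inner (Binf (j (ys n))) (j (ys n))) -
          (L (j (xs n)) - 1/2 * inner (Binf (j (xs n))) (j (xs n)))\<bar>
        \<le> l * max (norm (j (xs n))) (norm (j (ys n))) * norm (j (ys n) - j (xs n))"
      using ev by eventually_elim (rule L_segment_dense[OF w(1)])
  qed
qed

text \<open>Concavity is needed at points \<open>u + v\<close> of the whole space, while the second derivative exists only at
points of the dense subspace.  Approximating the base point \<open>u + v\<close> keeps the direction of the fibre in the
dense subspace; the radius \<open>R' + 1\<close> in place of \<open>R'\<close> leaves room for the approximation.\<close>

lemma saddle_structure:
  obtains E R1 where "finite E" "orthonormal_set E"
    "pos_subspace Binf = {u. \<forall>e\<in>E. inner u e = 0}" "neg_subspace Binf = span E"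
    "saddle_at_infinity Binf (pos_subspace Binf) (neg_subspace Binf)
      (\<lambda>x. x - orthonormal_expansion E x) L a l R R1"
proof -
  obtain C0 where C0: "C0 > 0" "\<And>u. C0 * (norm u)\<^sup>2 \<le> inner (Pinf u) u" using Pinf_coercive by blast
  obtain E where E: "finite E" "orthonormal_set E" "\<And>e. e \<in> E \<Longrightarrow> \<exists>c<0. Binf e = c *\<^sub>R e"
    and M: "pos_subspace Binf = {u. \<forall>e\<in>E. inner u e = 0}" and N: "neg_subspace Binf = span E"
    using spectral_splitting[OF decomp(2) Binf_sa C0 Qinf ker] by blast
  obtain R' where R': "R \<le> R'"
    "\<And>x v. R' \<le> norm (j x) \<Longrightarrow> v \<in> span E \<Longrightarrow> inner (B x v) v \<le> - a * (norm v)\<^sup>2"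
    using B_negative_on_span[OF E(1,2) N] by blast
  have span_X: "\<exists>w. v = j w" if "v \<in> span E" for v
  proof -
    have "E \<subseteq> range j" using E(3) neg_eigenvectors by blast
    moreover have "subspace (range j)" using lin by (simp add: linear_subspace_image)
    ultimately have "span E \<subseteq> range j" by (rule span_minimal)
    then show ?thesis using that by blast
  qed
  let ?p = "\<lambda>x. x - orthonormal_expansion E x"
  have p: "bounded_linear ?p"
    by (intro bounded_linear_sub bounded_linear_ident bounded_linear_orthonormal_expansion)
  have pM: "?p x \<in> pos_subspace Binf" for x
    unfolding M using inner_orthonormal_expansion[OF E(1,2)] by (simp add: inner_diff_left)
  have orth: "inner u v = 0" if "u \<in> pos_subspace Binf" "v \<in> neg_subspace Binf" for u v
    using orth_to_span that unfolding M N by blast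
  have p_norm: "norm (?p x) \<le> norm x" for x
  proof (rule power2_le_imp_le)
    have "inner (?p x) (orthonormal_expansion E x) = 0"
      using orth[OF pM] orthonormal_expansion_in_span unfolding N by blast
    then have "(norm x)\<^sup>2 = (norm (?p x))\<^sup>2 + (norm (orthonormal_expansion E x))\<^sup>2"
      using norm_add_Pythagorean[of "?p x" "orthonormal_expansion E x"] by (simp add: orthogonal_def)
    then show "(norm (?p x))\<^sup>2 \<le> (norm x)\<^sup>2" by simp
  qed simp
  have p_eq: "?p (u + v) = u" if "u \<in> pos_subspace Binf" "v \<in> span E" for u v
  proof -
    have "orthonormal_expansion E u = 0"
      using that(1) unfolding M orthonormal_expansion_def by simp
    then show ?thesis using orthonormal_expansion_span[OF E(1,2) that(2)]
      by (simp add: bounded_linear_orthonormal_expansion linear_add bounded_linear.linear)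
  qed
  have "saddle_at_infinity Binf (pos_subspace Binf) (neg_subspace Binf) ?p L a l R (R' + 1)"
  proof (rule saddle_at_infinity.intro)
    show "subspace (pos_subspace Binf)" unfolding M subspace_def by (auto simp: inner_add_left)
    show "subspace (neg_subspace Binf)" unfolding N by simp
    show "x - ?p x \<in> neg_subspace Binf" for x unfolding N by (simp add: orthonormal_expansion_in_span)
    show "Binf u \<in> pos_subspace Binf" if u: "u \<in> pos_subspace Binf" for u
      unfolding M
    proof (intro CollectI ballI)
      fix e assume e: "e \<in> E"
      obtain c where "Binf e = c *\<^sub>R e" using E(3)[OF e] by blast
      then show "inner (Binf u) e = 0"
        using Binf_sa u e unfolding self_adjoint_def M by simp
    qed
    show "continuous_on {x. R \<le> norm x} L" by (rule continuous_on_subset[OF L_cont]) (use R(2) in blast)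
    fix u v w and t :: real
    assume u: "u \<in> pos_subspace Binf" "R' + 1 \<le> norm u" and vw: "v \<in> neg_subspace Binf" "w \<in> neg_subspace Binf"
      and t: "0 \<le> t" "t \<le> 1"
    \<comment> \<open>The segment from \<open>u + v\<close> to \<open>u + w\<close> is approximated by parallel segments that start in the
      dense subspace.\<close>
    define d where "d = w - v"
    have dN: "d \<in> span E" unfolding d_def using vw N by (simp add: span_diff)
    obtain dx where dx: "j dx = d" using span_X[OF dN] by metis
    obtain xs where xs: "(\<lambda>n. j (xs n)) \<longlonglongrightarrow> u + v" by (rule approximating_sequence)
    have far: "R < norm (u + v + s *\<^sub>R d)" for s
    proof -
      have "v + s *\<^sub>R d \<in> span E" using vw dN unfolding N by (simp add: span_add span_scale)
      from p_eq[OF u(1) this] p_norm[of "u + (v + s *\<^sub>R d)"] show ?thesis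
        using u(2) R'(1) by (simp add: add.assoc)
    qed
    have lim: "(\<lambda>n. L (j (xs n) + s *\<^sub>R d)) \<longlonglongrightarrow> L (u + v + s *\<^sub>R d)" for s
      by (rule tendsto_L[OF _ far]) (intro tendsto_intros xs)
    have "(\<lambda>n. norm (?p (j (xs n)))) \<longlonglongrightarrow> norm (?p (u + v))"
      by (intro tendsto_norm bounded_linear.tendsto[OF p] xs)
    then have "\<forall>\<^sub>F n in sequentially. R' < norm (?p (j (xs n)))"
      by (rule order_tendstoD) (use u vw N p_eq in simp)
    then have ev: "\<forall>\<^sub>F n in sequentially. (1 - t) * L (j (xs n)) + t * L (j (xs n) + d)
        + a/2 * (t * (1 - t)) * (norm d)\<^sup>2 \<le> L (j (xs n) + t *\<^sub>R d)"
    proof eventually_elim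
      case (elim n)
      have big: "R' \<le> norm (j (xs n) + s *\<^sub>R d)" for s
      proof -
        have eq: "?p (j (xs n) + s *\<^sub>R d) = ?p (j (xs n))"
          using orthonormal_expansion_span[OF E(1,2), of "s *\<^sub>R d"] dN
          by (simp add: linear_add[OF bounded_linear.linear[OF bounded_linear_orthonormal_expansion]] span_scale)
        show ?thesis using elim p_norm[of "j (xs n) + s *\<^sub>R d"] unfolding eq by linarith
      qed
      show ?case
      proof (rule L_concave_dense[OF dx _ _ t])
        show "R \<le> norm (j (xs n) + s *\<^sub>R d)" for s using big[of s] R'(1) by simp
        show "inner (B (xs n + s *\<^sub>R dx) d) d \<le> - a * (norm d)\<^sup>2" for s
          using big[of s] dN by (intro R'(2)) (simp_all add: j_simps dx)
      qed
    qed
    have "(1 - t) * L (u + v) + t * L (u + v + d) + a/2 * (t * (1 - t)) * (norm d)\<^sup>2 \<le> L (u + v + t *\<^sub>R d)"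
      using lim[of 0] lim[of 1] ev
      by (intro tendsto_le[OF sequentially_bot lim[of t] _ ev] tendsto_intros) simp_all
    moreover have "u + v + d = u + w" "u + v + t *\<^sub>R d = u + ((1 - t) *\<^sub>R v + t *\<^sub>R w)" "norm d = norm (v - w)"
      unfolding d_def by (simp_all add: algebra_simps norm_minus_commute)
    ultimately show "(1 - t) * L (u + v) + t * L (u + w) + a/2 * (t * (1 - t)) * (norm (v - w))\<^sup>2
        \<le> L (u + ((1 - t) *\<^sub>R v + t *\<^sub>R w))" by simp
  qed (use Binf_sa p pM orth pos_form neg_form l R R' L_bound L_segment in auto)
  then show ?thesis using that E M N by blast
qed

end

section \<open>The chart at infinity\<close>

theorem theorem1p8:
  fixes j :: "'x::banach \<Rightarrow> 'h::{real_inner,complete_space}"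
    and V :: "'h set"
    and L :: "'h \<Rightarrow> real"
    and A :: "'x \<Rightarrow> 'x"
    and B P Q :: "'x \<Rightarrow> ('h \<Rightarrow>\<^sub>L 'h)"
    and Binf Pinf Qinf :: "'h \<Rightarrow>\<^sub>L 'h"
    and a l R :: real
  assumes j_inclusion: "linear j" "inj j" "closure (range j) = UNIV" "\<forall>x. norm (j x) \<le> norm x"
    and V_nbhd_infty: "open V" "\<exists>r>0. ball_infty UNIV r \<subseteq> V"
    and L_regular: "continuous_on V L" "cont_dir_differentiable_on V L"
    and A_regular: "continuous_on (j -` V) A" "cont_dir_differentiable_on (j -` V) A"
    and L_gradient: "\<forall>x u. j x \<in> V \<longrightarrow> dir_deriv L (j x) (j u) = inner (j (A x)) (j u)"
    and B_self_adjoint: "\<forall>x. j x \<in> V \<longrightarrow> self_adjoint (B x)" "self_adjoint Binf"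
    and Binf_X: "Binf ` range j \<subseteq> range j"
    and A_deriv: "\<forall>x u v. j x \<in> V \<longrightarrow> inner (j (dir_deriv A x u)) (j v) = inner (B x (j u)) (j v)"
    and spectrum: "0 \<notin> op_spectrum Binf \<or> 0 isolated_in op_spectrum Binf"
    and Binf_regularity: "\<forall>u. Binf u \<in> range j \<longrightarrow> u \<in> range j"
    and decomp: "\<forall>x. j x \<in> V \<longrightarrow> B x = P x + Q x" "Binf = Pinf + Qinf"
    and P_pos_def: "\<forall>x. j x \<in> V \<longrightarrow> positive_definite (P x)" "positive_definite Pinf"
    and Q_compact: "\<forall>x. j x \<in> V \<longrightarrow> compact_op (Q x)" "compact_op Qinf"
    and neg_eigenvectors: "\<forall>c<0. \<forall>u. Binf u = c *\<^sub>R u \<longrightarrow> u \<in> range j"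
    and P_limit:
      "\<forall>xs::nat \<Rightarrow> 'x. (\<forall>k. j (xs k) \<in> V) \<longrightarrow> filterlim (\<lambda>k. norm (j (xs k))) at_top sequentially \<longrightarrow>
         (\<forall>u. (\<lambda>k. norm (P (xs k) u - Pinf u)) \<longlonglongrightarrow> 0)"
    and Q_limit:
      "\<forall>e>0. \<exists>r. \<forall>x. j x \<in> V \<longrightarrow> norm (j x) > r \<longrightarrow> norm (Q x - Qinf) < e"
    and P_coercive:
      "\<forall>xs::nat \<Rightarrow> 'x. (\<forall>k. j (xs k) \<in> V) \<longrightarrow> filterlim (\<lambda>k. norm (j (xs k))) at_top sequentially \<longrightarrow>
         (\<exists>C0>0. \<exists>n0. \<forall>n\<ge>n0. \<forall>u. inner (P (xs n) u) u \<ge> C0 * (norm u)\<^sup>2)"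
    and a_infty: "a > 0"
      "\<forall>u\<in>pos_subspace Binf. inner (Binf u) u \<ge> 2 * a * (norm u)\<^sup>2"
      "\<forall>u\<in>neg_subspace Binf. inner (Binf u) u \<le> - 2 * a * (norm u)\<^sup>2"
    and nullity: "edim {u. Binf u = 0} = 0"
    and R: "R > 0" "cball_infty UNIV R \<subseteq> V"
    and l: "0 < l" "l < a"
    and L_bound: "\<forall>u\<in>cball_infty UNIV R. \<bar>L u - 1/2 * inner (Binf u) u\<bar> \<le> l * (norm u)\<^sup>2"
    and A_bound: "\<forall>x. j x \<in> cball_infty UNIV R \<longrightarrow> norm (j (A x) - Binf (j x)) \<le> l * norm (j x)"
  shows
    "(edim (neg_subspace Binf) = 0 \<longrightarrow>
       (\<exists>r>0. \<exists>\<phi>::'h \<Rightarrow> 'h.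
          homeo_onto_open_subset (ball_infty UNIV r) \<phi> V \<and>
          (\<forall>u\<in>ball_infty UNIV r.
             L (\<phi> u) = (norm u)\<^sup>2 \<and>
             norm u / sqrt (2 * norm Binf) \<le> norm (\<phi> u) \<and>
             norm (\<phi> u) \<le> 1 / sqrt (a - l) * norm u))) \<and>
     (edim (neg_subspace Binf) > 0 \<longrightarrow>
       (\<exists>r>0. \<exists>\<phi>::'h \<Rightarrow> 'h.
          (let D = {u + v | u v. u \<in> ball_infty (pos_subspace Binf) r \<and> v \<in> neg_subspace Binf} in
            homeo_onto_open_subset D \<phi> V \<and>
            (\<forall>u\<in>ball_infty (pos_subspace Binf) r. \<forall>v\<in>neg_subspace Binf.
               L (\<phi> (u + v)) = (norm u)\<^sup>2 - (norm v)\<^sup>2 \<and>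
               norm u / sqrt (2 * norm Binf) \<le> norm (orth_proj (pos_subspace Binf) (\<phi> (u + v))) \<and>
               norm (orth_proj (pos_subspace Binf) (\<phi> (u + v))) \<le> norm u / sqrt (a - l)) \<and>
            (pos_subspace Binf \<noteq> {0} \<longrightarrow>
               orth_proj (neg_subspace Binf) ` \<phi> ` D = neg_subspace Binf))))"
proof -
  have quadratic: "asymptotically_quadratic j V L A B P Q Binf Pinf Qinf a l R"
  proof (intro asymptotically_quadratic.intro dense_inclusion.intro asymptotically_quadratic_axioms.intro)
    fix u assume "Binf u = 0"
    then show "u = 0" using edim_zero_imp_trivial[OF nullity] by blast
  next
    fix x :: 'h assume "R \<le> norm x"
    then show "x \<in> V" using R(2) by (auto simp: cball_infty_def)
  next
    fix xs :: "nat \<Rightarrow> 'x" and u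
    assume "\<And>k. j (xs k) \<in> V" "filterlim (\<lambda>k. norm (j (xs k))) at_top sequentially"
    then show "(\<lambda>k. norm (P (xs k) u - Pinf u)) \<longlonglongrightarrow> 0" using P_limit by blast
  next
    fix xs :: "nat \<Rightarrow> 'x"
    assume "\<And>k. j (xs k) \<in> V" "filterlim (\<lambda>k. norm (j (xs k))) at_top sequentially"
    then show "\<exists>C0>0. \<exists>n0. \<forall>n\<ge>n0. \<forall>u. inner (P (xs n) u) u \<ge> C0 * (norm u)\<^sup>2"
      using P_coercive by blast
  next
    show "closure (range j) = UNIV" "self_adjoint Binf" "continuous_on V L"
      "cont_dir_differentiable_on V L" "cont_dir_differentiable_on (j -` V) A"
      "Binf = Pinf + Qinf" "compact_op Qinf" "linear j" "0 < R" "0 < l" "l < a"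
      by fact+
  next
    show "\<And>x. norm (j x) \<le> norm x" using j_inclusion(4) by blast
    show "\<And>x u. j x \<in> V \<Longrightarrow> dir_deriv L (j x) (j u) = inner (j (A x)) (j u)"
      using L_gradient by blast
    show "\<And>x u v. j x \<in> V \<Longrightarrow> inner (j (dir_deriv A x u)) (j v) = inner (B x (j u)) (j v)"
      using A_deriv by blast
    show "\<And>x. j x \<in> V \<Longrightarrow> B x = P x + Q x" using decomp(1) by blast
    show "\<And>c u. c < 0 \<Longrightarrow> Binf u = c *\<^sub>R u \<Longrightarrow> u \<in> range j" using neg_eigenvectors by blast
    show "\<And>e. e > 0 \<Longrightarrow> \<exists>r. \<forall>x. j x \<in> V \<longrightarrow> norm (j x) > r \<longrightarrow> norm (Q x - Qinf) < e"
      using Q_limit by blast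
    show "\<And>u. u \<in> pos_subspace Binf \<Longrightarrow> 2 * a * (norm u)\<^sup>2 \<le> inner (Binf u) u"
      using a_infty(2) by blast
    show "\<And>u. u \<in> neg_subspace Binf \<Longrightarrow> inner (Binf u) u \<le> - 2 * a * (norm u)\<^sup>2"
      using a_infty(3) by blast
    show "\<And>u. R \<le> norm u \<Longrightarrow> \<bar>L u - 1/2 * inner (Binf u) u\<bar> \<le> l * (norm u)\<^sup>2"
      using L_bound unfolding cball_infty_def by blast
    show "\<And>x. R \<le> norm (j x) \<Longrightarrow> norm (j (A x) - Binf (j x)) \<le> l * norm (j x)"
      using A_bound unfolding cball_infty_def by blast
  qed
  interpret asymptotically_quadratic j V L A B P Q Binf Pinf Qinf a l R by (rule quadratic)
  define M where "M = pos_subspace Binf"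
  define N where "N = neg_subspace Binf"
  obtain E R1
    where saddle: "saddle_at_infinity Binf M N (\<lambda>x. x - orthonormal_expansion E x) L a l R R1"
    unfolding M_def N_def by (rule saddle_structure)
  interpret S: saddle_at_infinity Binf M N "\<lambda>x. x - orthonormal_expansion E x" L a l R R1
    by (rule saddle)
  have proj_M: "orth_proj M y = y - orthonormal_expansion E y" for y
    using S.p(2,3)[of y] S.orth S.subspaces(1)
    by (intro orth_proj_eqI) (auto simp: inner_commute)
  have proj_N: "orth_proj N y = y - orth_proj M y" for y
    unfolding proj_M using S.p(2,3)[of y] S.orth S.subspaces(2) by (intro orth_proj_eqI) auto
  obtain r \<phi> \<psi> where r: "r > 0" and chart:
    "open (\<phi> ` {u + v | u v. u \<in> ball_infty M r \<and> v \<in> N})"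
    "\<phi> ` {u + v | u v. u \<in> ball_infty M r \<and> v \<in> N} \<subseteq> {x. R < norm x}"
    "homeomorphism {u + v | u v. u \<in> ball_infty M r \<and> v \<in> N}
      (\<phi> ` {u + v | u v. u \<in> ball_infty M r \<and> v \<in> N}) \<phi> \<psi>"
    and chart_value: "\<forall>u\<in>ball_infty M r. \<forall>v\<in>N. L (\<phi> (u + v)) = (norm u)\<^sup>2 - (norm v)\<^sup>2 \<and>
      norm u / sqrt (2 * norm Binf) \<le> norm (orth_proj M (\<phi> (u + v))) \<and>
      norm (orth_proj M (\<phi> (u + v))) \<le> norm u / sqrt (a - l)"
    and onto: "M \<noteq> {0} \<longrightarrow> orth_proj N ` \<phi> ` {u + v | u v. u \<in> ball_infty M r \<and> v \<in> N} = N"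
    using S.saddle_chart[folded proj_M, folded proj_N] by (elim exE conjE) (rule that)
  have homeo: "homeo_onto_open_subset {u + v | u v. u \<in> ball_infty M r \<and> v \<in> N} \<phi> V"
    unfolding homeo_onto_open_subset_def using chart R(2) by (fastforce simp: cball_infty_def)
  show ?thesis
    unfolding M_def[symmetric] N_def[symmetric]
  proof (intro conjI impI)
    show "\<exists>r>0. \<exists>\<phi>. let D = {u + v | u v. u \<in> ball_infty M r \<and> v \<in> N} in
        homeo_onto_open_subset D \<phi> V \<and>
        (\<forall>u\<in>ball_infty M r. \<forall>v\<in>N. L (\<phi> (u + v)) = (norm u)\<^sup>2 - (norm v)\<^sup>2 \<and>
          norm u / sqrt (2 * norm Binf) \<le> norm (orth_proj M (\<phi> (u + v))) \<and>
          norm (orth_proj M (\<phi> (u + v))) \<le> norm u / sqrt (a - l)) \<and>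
        (M \<noteq> {0} \<longrightarrow> orth_proj N ` \<phi> ` D = N)"
      unfolding Let_def using r homeo chart_value onto by (intro exI[of _ r] exI[of _ \<phi>] conjI)
  next
    \<comment> \<open>With the negative subspace trivial, the positive one is the whole space.\<close>
    assume "edim N = 0"
    then have N0: "N = {0}"
      using edim_zero_imp_trivial S.subspaces(2) subspace_0 by blast
    have proj: "orth_proj M y = y" for y
      unfolding proj_M using S.p(3)[of y] unfolding N0 by simp
    have MU: "M = UNIV" using S.p(2) proj unfolding proj_M by (metis UNIV_eq_I)
    have D: "{u + v | u v. u \<in> ball_infty M r \<and> v \<in> N} = ball_infty UNIV r"
      unfolding N0 MU by auto
    show "\<exists>r>0. \<exists>\<phi>::'h \<Rightarrow> 'h. homeo_onto_open_subset (ball_infty UNIV r) \<phi> V \<and>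
        (\<forall>u\<in>ball_infty UNIV r. L (\<phi> u) = (norm u)\<^sup>2 \<and>
          norm u / sqrt (2 * norm Binf) \<le> norm (\<phi> u) \<and> norm (\<phi> u) \<le> 1 / sqrt (a - l) * norm u)"
    proof (intro exI[of _ r] exI[of _ \<phi>] conjI ballI r)
      show "homeo_onto_open_subset (ball_infty UNIV r) \<phi> V" using homeo unfolding D .
      fix u :: 'h assume "u \<in> ball_infty UNIV r"
      with chart_value[rule_format, of u 0] show "L (\<phi> u) = (norm u)\<^sup>2"
        "norm u / sqrt (2 * norm Binf) \<le> norm (\<phi> u)" "norm (\<phi> u) \<le> 1 / sqrt (a - l) * norm u"
        unfolding MU[symmetric] N0 by (auto simp: proj)
    qed
  qed
qed

end
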